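(* Let $\mathbf A$ be a finite symmetric relation algebra with a normal representation such that $\mathbf A$ has all $1$-cycles and admits a Siggers behavior; let $\mathfrak A_0$ be its atom structure and $\mathfrak A_0^b$ its binarisation, and assume that $\mathrm{Pol}(\mathfrak A_0^b)$ contains a Siggers operation and $\mathfrak A_0^b$ has no affine edge. Let $v,w\in\mathrm{Pol}(\mathfrak A_0^b)$ be binary resp. ternary operations such that for every two-element $C\subseteq A_0$: $v|_C$ is a semilattice operation if $C$ has a semilattice edge in $\mathfrak A_0^b$ and $v|_C(x,y)=x$ otherwise; $w|_C$ is a majority operation if $C$ is a majority edge of $\mathfrak A_0^b$ and $w|_C(x,y,z)=v|_C(v|_C(x,y),z)$ if $C$ has a semilattice edge. Let $u(x,y,z):=w(v(v(x,y),z),v(v(y,z),x),v(v(z,x),y))$. If $u\in\mathrm{Pol}(\mathfrak A_0^b)$, then $u\in\mathrm{Pol}(\mathfrak A_0)$.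
   Context: $\mathbf A=(A;\cup,\bar{\ },0,1,\mathrm{id},\breve{\ },\circ)$ is a relation algebra (Tarski's axioms), symmetric if $\breve a=a$; $A_0$ is its set of atoms; $R=\{(x,y,z)\in A_0^3\mid z\le x\circ y\}$ is the set of allowed triples. $\mathbf A$ has all $1$-cycles if $(a,a,a)\in R$ for all $a$; it admits a Siggers behavior if there is $s\colon A_0^6\to A_0$ preserving $R$, with $s(x_1,\dots,x_6)\in\{x_1,\dots,x_6\}$ and $s(x,x,y,y,z,z)=s(y,z,x,z,x,y)$. A normal representation is a representation that is square, homogeneous and fully universal (every atomic closed network satisfiable in it). The atom structure $\mathfrak A_0$ has domain $A_0$, a unary relation for every subset of $A_0$, the binary relation $\{(a_1,a_2)\mid\breve{a_1}=a_2\}$, and $R$. The binarisation $\mathfrak A_0^b$ has domain $A_0$, unary relations $U_S$ for all $S\subseteq A_0$, binary relations $R_a=\{(x,y)\mid (a,x,y)\in R\}$ for $a\in A_0$, and every union of relations $R_a$. $\mathrm{Pol}(\mathfrak C)$ is the set of polymorphisms (homomorphisms $\mathfrak C^n\to\mathfrak C$). Edge notions for $\mathfrak A_0^b$: $(a,b)$ is a semilattice edge if some binary polymorphism $p$ has $p(a,b)=p(b,a)=p(b,b)=b$, $p(a,a)=a$; $\{a,b\}$ has a semilattice edge if $(a,b)$ or $(b,a)$ is one; $\{a,b\}$ is a majority edge if it has no semilattice edge and some ternary polymorphism is a majority operation on $\{a,b\}$; it is an affine edge if it is neither but some ternary polymorphism is a minority operation on $\{a,b\}$. A Siggers operation is a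 6-ary $s$ with $s(x,x,y,y,z,z)=s(y,z,x,z,x,y)$. *)

theory Defs
  imports Main
begin

section \<open>Relation algebras\<close>

class relation_algebra = boolean_algebra +
  fixes ident :: 'a
    and conv :: "'a \<Rightarrow> 'a"
    and rcomp :: "'a \<Rightarrow> 'a \<Rightarrow> 'a"  (infixl "\<odot>" 75)
  assumes rcomp_assoc: "(x \<odot> y) \<odot> z = x \<odot> (y \<odot> z)"
    and rcomp_sup: "sup x y \<odot> z = sup (x \<odot> z) (y \<odot> z)"
    and rcomp_ident: "x \<odot> ident = x"
    and conv_conv: "conv (conv x) = x"
    and conv_sup: "conv (sup x y) = sup (conv x) (conv y)"
    and conv_rcomp: "conv (x \<odot> y) = conv y \<odot> conv x"
    and conv_rcomp_compl: "conv x \<odot> (- (x \<odot> y)) \<le> - y"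

definition atoms :: "'a::relation_algebra set" where
  "atoms = {a. a \<noteq> bot \<and> (\<forall>b. b \<le> a \<longrightarrow> b = bot \<or> b = a)}"

definition allowed_triples :: "('a::relation_algebra \<times> 'a \<times> 'a) set" where
  "allowed_triples = {(x, y, z). x \<in> atoms \<and> y \<in> atoms \<and> z \<in> atoms \<and> z \<le> x \<odot> y}"


section \<open>Relational structures and polymorphisms\<close>

text \<open>Tuples are lists, so that one notion of structure covers relations of every arity and
  every finite power. The signature consists of \<open>symbols\<close> and \<open>arity\<close>.\<close>

record ('s, 'c) rel_structure =
  universe :: "'c set"
  symbols :: "'s set"
  arity :: "'s \<Rightarrow> nat"
  interp :: "'s \<Rightarrow> 'c list set"

definition tuples :: "'c set \<Rightarrow> nat \<Rightarrow> 'c list set" where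
  "tuples D n = {t. length t = n \<and> set t \<subseteq> D}"

definition wf_structure :: "('s, 'c) rel_structure \<Rightarrow> bool" where
  "wf_structure C \<longleftrightarrow> (\<forall>r \<in> symbols C. interp C r \<subseteq> tuples (universe C) (arity C r))"

definition homomorphism ::
    "('s, 'c) rel_structure \<Rightarrow> ('s, 'd) rel_structure \<Rightarrow> ('c \<Rightarrow> 'd) \<Rightarrow> bool" where
  "homomorphism C D h \<longleftrightarrow>
     h ` universe C \<subseteq> universe D \<and>
     (\<forall>r \<in> symbols C. \<forall>t \<in> interp C r. map h t \<in> interp D r)"

definition isomorphism ::
    "('s, 'c) rel_structure \<Rightarrow> ('s, 'd) rel_structure \<Rightarrow> ('c \<Rightarrow> 'd) \<Rightarrow> bool" where
  "isomorphism C D h \<longleftrightarrow>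
     bij_betw h (universe C) (universe D) \<and>
     (\<forall>r \<in> symbols C. \<forall>t \<in> tuples (universe C) (arity C r).
        t \<in> interp C r \<longleftrightarrow> map h t \<in> interp D r)"

definition substructure :: "('s, 'c) rel_structure \<Rightarrow> 'c set \<Rightarrow> ('s, 'c) rel_structure" where
  "substructure C S = C\<lparr>universe := S, interp := (\<lambda>r. interp C r \<inter> tuples S (arity C r))\<rparr>"

definition power_structure :: "('s, 'c) rel_structure \<Rightarrow> nat \<Rightarrow> ('s, 'c list) rel_structure" where
  "power_structure C n =
     \<lparr>universe = tuples (universe C) n,
      symbols = symbols C,
      arity = arity C,
      interp = (\<lambda>r. {t \<in> tuples (tuples (universe C) n) (arity C r).
                       \<forall>i < n. map (\<lambda>x. x ! i) t \<in> interp C r})\<rparr>"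

text \<open>The \<open>n\<close>-ary polymorphisms; an operation takes the list of its arguments, and only its
  values on argument lists of length \<open>n\<close> over the universe matter.\<close>

definition Pol :: "('s, 'c) rel_structure \<Rightarrow> nat \<Rightarrow> ('c list \<Rightarrow> 'c) set" where
  "Pol C n = {f. homomorphism (power_structure C n) C f}"


section \<open>Normal representations\<close>

text \<open>The signature of a representation is the algebra itself, each element being a binary symbol.\<close>

definition bin_rel :: "('s, 'd) rel_structure \<Rightarrow> 's \<Rightarrow> ('d \<times> 'd) set" where
  "bin_rel B a = {(x, y). [x, y] \<in> interp B a}"

text \<open>The map sending \<open>a\<close> to its interpretation is an isomorphism onto a subalgebra of the
  algebra of all subrelations of the equivalence relation interpreting \<open>top\<close>.\<close>

definition representation :: "('a::relation_algebra, 'd) rel_structure \<Rightarrow> bool" where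
  "representation B \<longleftrightarrow>
     wf_structure B \<and> symbols B = UNIV \<and> (\<forall>a. arity B a = 2) \<and>
     equiv (universe B) (bin_rel B top) \<and>
     inj (bin_rel B) \<and>
     (\<forall>a. bin_rel B a \<subseteq> bin_rel B top) \<and>
     (\<forall>a b. bin_rel B (sup a b) = bin_rel B a \<union> bin_rel B b) \<and>
     (\<forall>a. bin_rel B (- a) = bin_rel B top - bin_rel B a) \<and>
     bin_rel B bot = {} \<and>
     bin_rel B ident = Id_on (universe B) \<and>
     (\<forall>a. bin_rel B (conv a) = (bin_rel B a)\<inverse>) \<and>
     (\<forall>a b. bin_rel B (a \<odot> b) = bin_rel B a O bin_rel B b)"

definition square :: "('a::relation_algebra, 'd) rel_structure \<Rightarrow> bool" where
  "square B \<longleftrightarrow> bin_rel B top = universe B \<times> universe B"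

definition homogeneous :: "('s, 'd) rel_structure \<Rightarrow> bool" where
  "homogeneous B \<longleftrightarrow>
     (\<forall>S T h. finite S \<and> finite T \<and> S \<subseteq> universe B \<and> T \<subseteq> universe B \<and>
        isomorphism (substructure B S) (substructure B T) h \<longrightarrow>
        (\<exists>g. isomorphism B B g \<and> (\<forall>x \<in> S. g x = h x)))"

definition atomic_network :: "'v set \<Rightarrow> ('v \<Rightarrow> 'v \<Rightarrow> 'a::relation_algebra) \<Rightarrow> bool" where
  "atomic_network V f \<longleftrightarrow> (\<forall>x \<in> V. \<forall>y \<in> V. f x y \<in> atoms)"

definition closed_network :: "'v set \<Rightarrow> ('v \<Rightarrow> 'v \<Rightarrow> 'a::relation_algebra) \<Rightarrow> bool" where
  "closed_network V f \<longleftrightarrow>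
     (\<forall>x \<in> V. \<forall>y \<in> V. \<forall>z \<in> V.
        f x x \<le> ident \<and> f x y = conv (f y x) \<and> f x z \<le> f x y \<odot> f y z)"

definition satisfiable_in ::
    "('a::relation_algebra, 'd) rel_structure \<Rightarrow> 'v set \<Rightarrow> ('v \<Rightarrow> 'v \<Rightarrow> 'a) \<Rightarrow> bool" where
  "satisfiable_in B V f \<longleftrightarrow>
     (\<exists>s. s ` V \<subseteq> universe B \<and> (\<forall>x \<in> V. \<forall>y \<in> V. (s x, s y) \<in> bin_rel B (f x y)))"

text \<open>Networks have finitely many variables, so variables can be taken to be natural numbers.\<close>

definition fully_universal :: "('a::relation_algebra, 'd) rel_structure \<Rightarrow> bool" where
  "fully_universal B \<longleftrightarrow>
     (\<forall>(V :: nat set) f. finite V \<and> atomic_network V f \<and> closed_network V f \<longrightarrow>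
        satisfiable_in B V f)"

definition normal_representation :: "('a::relation_algebra, 'd) rel_structure \<Rightarrow> bool" where
  "normal_representation B \<longleftrightarrow>
     representation B \<and> square B \<and> homogeneous B \<and> fully_universal B"


section \<open>The atom structure and its binarisation\<close>

datatype 'a atom_symbol = Unary "'a set" | Converse | Allowed

definition atom_structure :: "('a::relation_algebra atom_symbol, 'a) rel_structure" where
  "atom_structure =
     \<lparr>universe = atoms,
      symbols = Unary ` Pow atoms \<union> {Converse, Allowed},
      arity = (\<lambda>r. case r of Unary S \<Rightarrow> 1 | Converse \<Rightarrow> 2 | Allowed \<Rightarrow> 3),
      interp = (\<lambda>r. case r of
          Unary S \<Rightarrow> {[x] | x. x \<in> S}
        | Converse \<Rightarrow> {[x, y] | x y. x \<in> atoms \<and> y \<in> atoms \<and> conv x = y}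
        | Allowed \<Rightarrow> {[x, y, z] | x y z. (x, y, z) \<in> allowed_triples})\<rparr>"

text \<open>\<open>Slice a\<close> names the relation \<open>R\<^sub>a\<close>, and \<open>Slices S\<close> the union of the \<open>R\<^sub>a\<close> with \<open>a \<in> S\<close>.\<close>

datatype 'a bin_symbol = U "'a set" | Slice 'a | Slices "'a set"

definition binarisation :: "('a::relation_algebra bin_symbol, 'a) rel_structure" where
  "binarisation =
     \<lparr>universe = atoms,
      symbols = U ` Pow atoms \<union> Slice ` atoms \<union> Slices ` Pow atoms,
      arity = (\<lambda>r. case r of U S \<Rightarrow> 1 | Slice a \<Rightarrow> 2 | Slices S \<Rightarrow> 2),
      interp = (\<lambda>r. case r of
          U S \<Rightarrow> {[x] | x. x \<in> S}
        | Slice a \<Rightarrow> {[x, y] | x y. (a, x, y) \<in> allowed_triples}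
        | Slices S \<Rightarrow> (\<Union>a \<in> S. {[x, y] | x y. (a, x, y) \<in> allowed_triples}))\<rparr>"


section \<open>Siggers operations\<close>

definition siggers_on :: "'c set \<Rightarrow> ('c list \<Rightarrow> 'c) \<Rightarrow> bool" where
  "siggers_on D s \<longleftrightarrow>
     (\<forall>x \<in> D. \<forall>y \<in> D. \<forall>z \<in> D. s [x, x, y, y, z, z] = s [y, z, x, z, x, y])"

definition siggers_behavior :: "('a::relation_algebra list \<Rightarrow> 'a) \<Rightarrow> bool" where
  "siggers_behavior s \<longleftrightarrow>
     (\<forall>x \<in> tuples atoms 6. \<forall>y \<in> tuples atoms 6. \<forall>z \<in> tuples atoms 6.
        (\<forall>i < 6. (x ! i, y ! i, z ! i) \<in> allowed_triples) \<longrightarrow>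
        (s x, s y, s z) \<in> allowed_triples) \<and>
     (\<forall>x \<in> tuples atoms 6. s x \<in> set x) \<and>
     siggers_on atoms s"


section \<open>Edges\<close>

definition semilattice_op_on :: "'c set \<Rightarrow> ('c list \<Rightarrow> 'c) \<Rightarrow> bool" where
  "semilattice_op_on C f \<longleftrightarrow>
     (\<forall>x \<in> C. \<forall>y \<in> C. f [x, y] \<in> C) \<and>
     (\<forall>x \<in> C. f [x, x] = x) \<and>
     (\<forall>x \<in> C. \<forall>y \<in> C. f [x, y] = f [y, x]) \<and>
     (\<forall>x \<in> C. \<forall>y \<in> C. \<forall>z \<in> C. f [f [x, y], z] = f [x, f [y, z]])"

definition majority_op_on :: "'c set \<Rightarrow> ('c list \<Rightarrow> 'c) \<Rightarrow> bool" where
  "majority_op_on C m \<longleftrightarrow>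
     (\<forall>x \<in> C. \<forall>y \<in> C. m [x, x, y] = x \<and> m [x, y, x] = x \<and> m [y, x, x] = x)"

definition minority_op_on :: "'c set \<Rightarrow> ('c list \<Rightarrow> 'c) \<Rightarrow> bool" where
  "minority_op_on C m \<longleftrightarrow>
     (\<forall>x \<in> C. \<forall>y \<in> C. m [x, y, y] = x \<and> m [y, x, y] = x \<and> m [y, y, x] = x)"

definition semilattice_edge :: "('s, 'c) rel_structure \<Rightarrow> 'c \<Rightarrow> 'c \<Rightarrow> bool" where
  "semilattice_edge \<CC> a b \<longleftrightarrow>
     a \<in> universe \<CC> \<and> b \<in> universe \<CC> \<and>
     (\<exists>p \<in> Pol \<CC> 2. p [a, b] = b \<and> p [b, a] = b \<and> p [b, b] = b \<and> p [a, a] = a)"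

definition two_subset :: "('s, 'c) rel_structure \<Rightarrow> 'c set \<Rightarrow> bool" where
  "two_subset \<CC> C \<longleftrightarrow> C \<subseteq> universe \<CC> \<and> card C = 2"

definition has_semilattice_edge :: "('s, 'c) rel_structure \<Rightarrow> 'c set \<Rightarrow> bool" where
  "has_semilattice_edge \<CC> C \<longleftrightarrow>
     two_subset \<CC> C \<and> (\<exists>a b. C = {a, b} \<and> semilattice_edge \<CC> a b)"

definition majority_edge :: "('s, 'c) rel_structure \<Rightarrow> 'c set \<Rightarrow> bool" where
  "majority_edge \<CC> C \<longleftrightarrow>
     two_subset \<CC> C \<and> \<not> has_semilattice_edge \<CC> C \<and> (\<exists>m \<in> Pol \<CC> 3. majority_op_on C m)"

definition affine_edge :: "('s, 'c) rel_structure \<Rightarrow> 'c set \<Rightarrow> bool" where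
  "affine_edge \<CC> C \<longleftrightarrow>
     two_subset \<CC> C \<and> \<not> has_semilattice_edge \<CC> C \<and> \<not> majority_edge \<CC> C \<and>
     (\<exists>m \<in> Pol \<CC> 3. minority_op_on C m)"

end

(*
  Let R be the set of allowed triples, a totally symmetric relation containing all (a,a,a).
  A polymorphism of the binarisation is a conservative operation f such that for rows in R the
  values satisfy (s, f y, f z) in R for some entry s of the first column; the point is that s
  may differ from f x.

  First, v itself preserves R: if (X,Y,Z) is the value of v on two rows, each coordinate can be
  corrected to a triple of R, and v combines two such corrections, which agree in one
  coordinate, to (X,Y,Z). The value (p,q,r) of u has corrections (a,q,r), (p,b,r), (p,q,c) as
  well. Unless the entries of a column form a cyclic triple of semilattice edges, the value of u
  absorbs that column under v; cyclic columns are handled by closing the rows and the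
  corrections under v. If v absorbs a, b, c into p, q, r, then a single semilattice edge
  finishes the argument through v, and a single edge with a majority operation in Pol(R)
  finishes it through that operation.

  In the remaining case the Siggers behavior gives a minority operation in Pol(R) on the pairs
  {p,a}, {q,b}, {r,c}, and R restricted to their product is an affine cube missing (p,q,r).
  Applying polymorphisms to cube rows and 1-cycles (s,s,s) forces all pairs taken from p, q, r
  to be affine too, then forces (p,p,q) and (p,p,r) into R, and finally (p,q,r) itself.
*)

theory Submission
  imports Defs
begin

section \<open>Conservative polymorphisms of a symmetric ternary relation\<close>

locale symmetric_triples =
  fixes D :: "'a set" and R :: "'a \<Rightarrow> 'a \<Rightarrow> 'a \<Rightarrow> bool"
  assumes finite_D: "finite D"
    and R_in: "R x y z \<Longrightarrow> x \<in> D \<and> y \<in> D \<and> z \<in> D"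
    and R_swap12: "R x y z \<Longrightarrow> R y x z"
    and R_swap23: "R x y z \<Longrightarrow> R x z y"
    and R_refl: "x \<in> D \<Longrightarrow> R x x x"
begin

lemma R_perms:
  assumes "R x y z"
  shows "R x z y" "R y x z" "R y z x" "R z x y" "R z y x"
  using assms R_swap12 R_swap23 by blast+

definition pol2 :: "('a \<Rightarrow> 'a \<Rightarrow> 'a) \<Rightarrow> bool" where
  "pol2 f \<longleftrightarrow> (\<forall>x\<in>D. \<forall>y\<in>D. f x y \<in> {x, y}) \<and>
    (\<forall>x y z x' y' z'. R x y z \<longrightarrow> R x' y' z' \<longrightarrow> R (f x x') (f y y') (f z z'))"

definition pol3 :: "('a \<Rightarrow> 'a \<Rightarrow> 'a \<Rightarrow> 'a) \<Rightarrow> bool" where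
  "pol3 f \<longleftrightarrow> (\<forall>x\<in>D. \<forall>y\<in>D. \<forall>z\<in>D. f x y z \<in> {x, y, z}) \<and>
    (\<forall>x y z x' y' z' x'' y'' z''. R x y z \<longrightarrow> R x' y' z' \<longrightarrow> R x'' y'' z'' \<longrightarrow>
      R (f x x' x'') (f y y' y'') (f z z' z''))"

lemma pol2_cases: "pol2 f \<Longrightarrow> x \<in> D \<Longrightarrow> y \<in> D \<Longrightarrow> f x y = x \<or> f x y = y"
  unfolding pol2_def by blast

lemma pol2_R: "pol2 f \<Longrightarrow> R x y z \<Longrightarrow> R x' y' z' \<Longrightarrow> R (f x x') (f y y') (f z z')"
  unfolding pol2_def by blast

lemma pol3_cases: "pol3 f \<Longrightarrow> x \<in> D \<Longrightarrow> y \<in> D \<Longrightarrow> z \<in> D \<Longrightarrow>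
    f x y z = x \<or> f x y z = y \<or> f x y z = z"
  unfolding pol3_def by blast

lemma pol3_idem: "pol3 f \<Longrightarrow> x \<in> D \<Longrightarrow> f x x x = x"
  using pol3_cases by blast

lemma pol3_R: "pol3 f \<Longrightarrow> R x y z \<Longrightarrow> R x' y' z' \<Longrightarrow> R x'' y'' z'' \<Longrightarrow>
    R (f x x' x'') (f y y' y'') (f z z' z'')"
  unfolding pol3_def by blast

text \<open>Each of \<open>X\<close>, \<open>Y\<close>, \<open>Z\<close> absorbs its correction
  \<open>s\<close>, \<open>t\<close>, \<open>r\<close> as left argument of \<open>v\<close>. If
  \<open>v\<close> commutes on the two entries of some coordinate, the absorption there is two-sided
  and \<open>v\<close> merges two corrections into the full triple. If it commutes in none, it is
  the first projection in all three, and the value is the first row.\<close>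

lemma pol2_of_slices:
  assumes cons: "\<And>a b. a \<in> D \<Longrightarrow> b \<in> D \<Longrightarrow> v a b = a \<or> v a b = b"
    and edge: "\<And>a b. a \<in> D \<Longrightarrow> b \<in> D \<Longrightarrow> v a b = v b a \<or> v a b = a \<and> v b a = b"
    and slices: "\<And>x y z x' y' z'. R x y z \<Longrightarrow> R x' y' z' \<Longrightarrow>
      R x (v y y') (v z z') \<or> R x' (v y y') (v z z')"
  shows "pol2 v"
  unfolding pol2_def
proof (intro conjI ballI allI impI)
  show "v x y \<in> {x, y}" if "x \<in> D" "y \<in> D" for x y using cons that by blast
next
  fix x y z x' y' z' assume R: "R x y z" "R x' y' z'"
  have D: "x \<in> D" "y \<in> D" "z \<in> D" "x' \<in> D" "y' \<in> D" "z' \<in> D"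
    using R_in[OF R(1)] R_in[OF R(2)] by auto
  define X Y Z where XYZ: "X = v x x'" "Y = v y y'" "Z = v z z'"
  have absorb: "v (v a b) c = v a b" "v a b = v b a \<Longrightarrow> v c (v a b) = v a b"
    if "a \<in> D" "b \<in> D" "c = a \<or> c = b" for a b c
    using cons[OF that(1,1)] cons[OF that(2,2)] cons[OF that(1,2)] edge[OF that(1,2)] that(3)
    by auto
  show "R (v x x') (v y y') (v z z')"
  proof (rule ccontr)
    assume "\<not> ?thesis"
    then have no: "\<not> R X Y Z" unfolding XYZ .
    obtain s where s: "s = x \<or> s = x'" "R s Y Z" using slices[OF R] XYZ by blast
    obtain t where t: "t = y \<or> t = y'" "R X t Z"
      using slices[OF R_perms(2)[OF R(1)] R_perms(2)[OF R(2)]] R_perms(2) XYZ by blast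
    obtain r where r: "r = z \<or> r = z'" "R X Y r"
      using slices[OF R_perms(4)[OF R(1)] R_perms(4)[OF R(2)]] R_perms(3) XYZ by blast
    have a: "v X s = X" "v Y t = Y" "v Z r = Z"
      using absorb(1) D s(1) t(1) r(1) unfolding XYZ by blast+
    have "v x x' \<noteq> v x' x"
    proof
      assume "v x x' = v x' x"
      then have "v s X = X" using absorb(2) D s(1) unfolding XYZ by blast
      \<comment> \<open>Both rows start with \<open>Z\<close>, so the two alternatives of
        \<open>slices\<close> coincide and leave \<open>R Z X Y\<close>.\<close>
      then show False
        using slices[OF R_perms(4)[OF s(2)] R_perms(4)[OF t(2)]] a no R_perms(3) by auto
    qed
    moreover have "v y y' \<noteq> v y' y"
    proof
      assume "v y y' = v y' y"
      then have "v t Y = Y" using absorb(2) D t(1) unfolding XYZ by blast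
      then show False
        using slices[OF R_perms(5)[OF t(2)] R_perms(5)[OF s(2)]] a no R_perms(5) by auto
    qed
    moreover have "v z z' \<noteq> v z' z"
    proof
      assume "v z z' = v z' z"
      then have "v r Z = Z" using absorb(2) D r(1) unfolding XYZ by blast
      then show False
        using slices[OF R_perms(3)[OF r(2)] R_perms(3)[OF s(2)]] a no R_perms(4) by auto
    qed
    ultimately have "X = x" "Y = y" "Z = z" using edge D unfolding XYZ by blast+
    then show False using R(1) no by simp
  qed
qed

lemma pol2_proj: "pol2 (\<lambda>x y. x)" "pol2 (\<lambda>x y. y)"
  unfolding pol2_def by auto

lemma pol3_proj: "pol3 (\<lambda>x y z. x)" "pol3 (\<lambda>x y z. y)" "pol3 (\<lambda>x y z. z)"
  unfolding pol3_def by auto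

lemma pol2_comp3:
  assumes "pol3 f" "pol2 g" "pol2 h" "pol2 k"
  shows "pol2 (\<lambda>x y. f (g x y) (h x y) (k x y))"
  unfolding pol2_def
proof (intro conjI ballI allI impI)
  fix x y assume "x \<in> D" "y \<in> D"
  then show "f (g x y) (h x y) (k x y) \<in> {x, y}"
    using pol2_cases[OF assms(2)] pol2_cases[OF assms(3)] pol2_cases[OF assms(4)]
      pol3_cases[OF assms(1)] by (metis insert_iff)
qed (intro pol3_R[OF assms(1)] pol2_R[OF assms(2)] pol2_R[OF assms(3)] pol2_R[OF assms(4)])

lemma pol3_comp3:
  assumes "pol3 f" "pol3 g" "pol3 h" "pol3 k"
  shows "pol3 (\<lambda>x y z. f (g x y z) (h x y z) (k x y z))"
  unfolding pol3_def
proof (intro conjI ballI allI impI)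
  fix x y z assume D: "x \<in> D" "y \<in> D" "z \<in> D"
  then have "g x y z \<in> {x, y, z}" "h x y z \<in> {x, y, z}" "k x y z \<in> {x, y, z}"
    using pol3_cases[OF assms(2) D] pol3_cases[OF assms(3) D] pol3_cases[OF assms(4) D] by auto
  moreover from this have "g x y z \<in> D" "h x y z \<in> D" "k x y z \<in> D" using D by auto
  ultimately show "f (g x y z) (h x y z) (k x y z) \<in> {x, y, z}"
    using pol3_cases[OF assms(1)] by (metis (no_types, lifting))
qed (intro pol3_R[OF assms(1)] pol3_R[OF assms(2)] pol3_R[OF assms(3)] pol3_R[OF assms(4)])

lemma pol3_minors:
  assumes "pol3 f"
  shows "pol2 (\<lambda>x y. f x x y)" "pol2 (\<lambda>x y. f x y x)" "pol2 (\<lambda>x y. f y x x)"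
  using pol2_comp3[OF assms] pol2_proj by auto

section \<open>Types of ternary operations on a pair\<close>

definition maj_on :: "('a \<Rightarrow> 'a \<Rightarrow> 'a \<Rightarrow> 'a) \<Rightarrow> 'a \<Rightarrow> 'a \<Rightarrow> bool" where
  "maj_on f a b \<longleftrightarrow> f a a b = a \<and> f b b a = b \<and> f a b a = a \<and> f b a b = b \<and>
    f b a a = a \<and> f a b b = b"

definition min_on :: "('a \<Rightarrow> 'a \<Rightarrow> 'a \<Rightarrow> 'a) \<Rightarrow> 'a \<Rightarrow> 'a \<Rightarrow> bool" where
  "min_on f a b \<longleftrightarrow> f a a b = b \<and> f b b a = a \<and> f a b a = b \<and> f b a b = a \<and>
    f b a a = b \<and> f a b b = a"

text \<open>As in the two definitions before, values on constant arguments are left out, because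
  conservativity fixes them.\<close>

definition fst_on :: "('a \<Rightarrow> 'a \<Rightarrow> 'a \<Rightarrow> 'a) \<Rightarrow> 'a \<Rightarrow> 'a \<Rightarrow> bool" where
  "fst_on f a b \<longleftrightarrow> f a a b = a \<and> f b b a = b \<and> f a b a = a \<and> f b a b = b \<and>
    f b a a = b \<and> f a b b = a"

definition proj_on :: "('a \<Rightarrow> 'a \<Rightarrow> 'a \<Rightarrow> 'a) \<Rightarrow> 'a \<Rightarrow> 'a \<Rightarrow> bool" where
  "proj_on f a b \<longleftrightarrow> fst_on f a b \<or> fst_on (\<lambda>x y z. f y z x) a b \<or> fst_on (\<lambda>x y z. f z x y) a b"

text \<open>Majority and minority are invariant under rotating the arguments. So they survive when
  the inner operation is a projection, whose three rotations only rotate the arguments of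
  \<open>f\<close>.\<close>

definition cyc_comp (infixl "\<star>" 70) where
  "(f \<star> g) = (\<lambda>x y z. f (g x y z) (g y z x) (g z x y))"

text \<open>The classical term that makes a majority operation from a Pixley operation, one with
  \<open>f x y x = x\<close>, \<open>f x y y = x\<close> and \<open>f x x y = y\<close>.\<close>

definition pixley_step where
  "pixley_step f = (\<lambda>x y z. f x (f x y z) z)"

definition rotate_args where
  "rotate_args f = (\<lambda>x y z. f y z x)"

text \<open>There are three Pixley types, permuted cyclically by rotating arguments. A step turns one of
  them into majority, turns minority into a projection and leaves the other types alone.\<close>

definition pixley_to_maj where
  "pixley_to_maj f =
    pixley_step (rotate_args (pixley_step (rotate_args (pixley_step f))))"

lemma pol3_rotate: "pol3 f \<Longrightarrow> pol3 (rotate_args f)"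
  unfolding rotate_args_def using pol3_comp3 pol3_proj by fast

lemma pol3_pixley_step: "pol3 f \<Longrightarrow> pol3 (pixley_step f)"
  unfolding pixley_step_def using pol3_comp3[of f "\<lambda>x y z. x" f "\<lambda>x y z. z"] pol3_proj by fast

lemma pol3_pixley_to_maj: "pol3 f \<Longrightarrow> pol3 (pixley_to_maj f)"
  unfolding pixley_to_maj_def by (simp add: pol3_rotate pol3_pixley_step)

lemma pol3_cyc_comp:
  assumes "pol3 f" "pol3 g"
  shows "pol3 (f \<star> g)"
  using pol3_comp3[OF assms(1) assms(2) pol3_rotate[OF assms(2)]
      pol3_rotate[OF pol3_rotate[OF assms(2)]]]
  by (simp add: cyc_comp_def rotate_args_def)

text \<open>By conservativity, every binary polymorphism is a projection on such a pair.\<close>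

definition rigid :: "'a \<Rightarrow> 'a \<Rightarrow> bool" where
  "rigid a b \<longleftrightarrow> a \<in> D \<and> b \<in> D \<and> a \<noteq> b \<and> (\<forall>f. pol2 f \<longrightarrow> f a b \<noteq> f b a)"

lemma rigid_pol2:
  assumes "rigid a b" "pol2 f"
  shows "f a b = a \<and> f b a = b \<or> f a b = b \<and> f b a = a"
  using assms pol2_cases unfolding rigid_def by metis

text \<open>Each of the three binary minors is one of the two projections on the pair. This leaves
  eight types: majority, minority, three projections and three Pixley types.\<close>

lemma rigid_pol3:
  assumes "rigid a b" "pol3 f"
  obtains "f a a a = a" "f b b b = b"
    "f a a b = a \<and> f b b a = b \<or> f a a b = b \<and> f b b a = a"
    "f a b a = a \<and> f b a b = b \<or> f a b a = b \<and> f b a b = a"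
    "f b a a = a \<and> f a b b = b \<or> f b a a = b \<and> f a b b = a"
  using rigid_pol2[OF assms(1) pol3_minors(1)[OF assms(2)]]
    rigid_pol2[OF assms(1) pol3_minors(2)[OF assms(2)]]
    rigid_pol2[OF assms(1) pol3_minors(3)[OF assms(2)]]
    pol3_idem[OF assms(2)] assms(1) unfolding rigid_def by blast

lemma pixley_to_maj_on:
  assumes "rigid a b" "pol3 f"
  shows "(maj_on (pixley_to_maj f) a b \<and> \<not> min_on f a b \<and> \<not> proj_on f a b) \<or>
    (proj_on (pixley_to_maj f) a b \<and> (min_on f a b \<or> proj_on f a b))"
proof -
  have "a \<noteq> b" using assms(1) unfolding rigid_def by blast
  then show ?thesis
    by (rule_tac rigid_pol3[OF assms]; elim disjE conjE;
      simp add: pixley_to_maj_def pixley_step_def rotate_args_def maj_on_def min_on_def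
        proj_on_def fst_on_def)
qed

text \<open>If \<open>g\<close> is majority, its three rotated values agree and \<open>f\<close>
  returns them by idempotence; if \<open>g\<close> is a projection, \<open>f\<close> sees the
  arguments rotated. Hence composing never loses a majority already won on some pair.\<close>

lemma cyc_comp_maj:
  assumes "maj_on g a b \<or> proj_on g a b" "maj_on f a b \<or> proj_on f a b"
    "rigid a b" "pol3 f" "pol3 g"
  shows "maj_on (f \<star> g) a b \<or> proj_on (f \<star> g) a b"
    "maj_on f a b \<or> maj_on g a b \<Longrightarrow> maj_on (f \<star> g) a b"
proof -
  have [simp]: "f a a a = a" "f b b b = b" "g a a a = a" "g b b b = b"
    using assms pol3_idem unfolding rigid_def by blast+
  show "maj_on (f \<star> g) a b \<or> proj_on (f \<star> g) a b"
    using assms(1,2) unfolding proj_on_def maj_on_def fst_on_def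
    by (elim disjE conjE; simp add: cyc_comp_def)
  show "maj_on (f \<star> g) a b" if "maj_on f a b \<or> maj_on g a b"
    using assms(1,2) that unfolding proj_on_def maj_on_def fst_on_def
    by (elim disjE conjE; simp add: cyc_comp_def)
qed

lemma cyc_comp_min:
  assumes "min_on g a b \<or> proj_on g a b" "min_on f a b \<or> proj_on f a b"
    "min_on f a b \<or> min_on g a b" "rigid a b" "pol3 f" "pol3 g"
  shows "min_on (f \<star> g) a b"
proof -
  have [simp]: "f a a a = a" "f b b b = b" "g a a a = a" "g b b b = b"
    using assms pol3_idem unfolding rigid_def by blast+
  show ?thesis
    using assms(1,2,3) unfolding proj_on_def min_on_def fst_on_def
    by (elim disjE conjE; simp add: cyc_comp_def)
qed

text \<open>On a pair where \<open>m\<close> is the \<open>i\<close>-th projection, with \<open>i\<close> counted from 0,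
  \<open>m \<star> m \<star> m\<close> is the projection with index \<open>3 i = 0\<close> modulo 3.\<close>

lemma cyc_comp_cube:
  assumes "proj_on m a b" "rigid a b" "pol3 m"
  shows "fst_on (m \<star> m \<star> m) a b"
proof -
  have [simp]: "m a a a = a" "m b b b = b"
    using assms pol3_idem unfolding rigid_def by blast+
  show ?thesis
    using assms(1) unfolding proj_on_def fst_on_def
    by (elim disjE conjE; simp add: cyc_comp_def)
qed

section \<open>Single operations that serve all rigid pairs at once\<close>

definition has_maj :: "'a \<Rightarrow> 'a \<Rightarrow> bool" where
  "has_maj a b \<longleftrightarrow> (\<exists>f. pol3 f \<and> maj_on f a b)"

text \<open>Majorities are collected pair by pair with \<open>\<star>\<close>. The result may be a
  different projection on different pairs without majority; its threefold product is the first
  projection on all of them.\<close>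

lemma uniform_maj:
  "\<exists>m. pol3 m \<and> (\<forall>a b. rigid a b \<longrightarrow> (if has_maj a b then maj_on m a b else fst_on m a b))"
proof -
  have mm: "\<exists>m. pol3 m \<and> (\<forall>a b. rigid a b \<longrightarrow> maj_on m a b \<or> proj_on m a b) \<and>
      (\<forall>(a, b)\<in>S. rigid a b \<longrightarrow> has_maj a b \<longrightarrow> maj_on m a b)" if "finite S" for S
    using that
  proof (induction S)
    case empty
    have "proj_on (\<lambda>x y z. x) a b" for a b
      unfolding proj_on_def fst_on_def by simp
    then show ?case using pol3_proj(1) by blast
  next
    case (insert ab S)
    then obtain m where m: "pol3 m" "\<And>a b. rigid a b \<Longrightarrow> maj_on m a b \<or> proj_on m a b"
      "\<And>a b. (a, b) \<in> S \<Longrightarrow> rigid a b \<Longrightarrow> has_maj a b \<Longrightarrow> maj_on m a b" by blast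
    obtain a0 b0 where ab: "ab = (a0, b0)" by (cases ab)
    show ?case
    proof (cases "rigid a0 b0 \<and> has_maj a0 b0")
      case False
      then show ?thesis using m ab by (intro exI[of _ m]) auto
    next
      case True
      then obtain f where f: "pol3 f" "maj_on f a0 b0" unfolding has_maj_def by blast
      have ne: "a0 \<noteq> b0" using True unfolding rigid_def by blast
      \<comment> \<open>Normalising \<open>f\<close> removes minority and Pixley behavior on all
        other rigid pairs, as \<open>cyc_comp_maj\<close> requires, and keeps the majority on
        \<open>a0\<close>, \<open>b0\<close>.\<close>
      let ?g = "pixley_to_maj f"
      have g: "pol3 ?g" "\<And>a b. rigid a b \<Longrightarrow> maj_on ?g a b \<or> proj_on ?g a b"
        using f(1) pol3_pixley_to_maj pixley_to_maj_on by blast+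
      have "\<not> min_on f a0 b0" "\<not> proj_on f a0 b0"
        using f(2) ne unfolding maj_on_def min_on_def proj_on_def fst_on_def by auto
      then have g0: "maj_on ?g a0 b0" using True f(1) pixley_to_maj_on by blast
      show ?thesis
      proof (intro exI[of _ "m \<star> ?g"] conjI allI impI ballI)
        show "pol3 (m \<star> ?g)" using m(1) g(1) by (rule pol3_cyc_comp)
        show "maj_on (m \<star> ?g) a b \<or> proj_on (m \<star> ?g) a b" if "rigid a b" for a b
          using cyc_comp_maj(1) m(1,2) g that by blast
        show "case x of (a, b) \<Rightarrow> rigid a b \<longrightarrow> has_maj a b \<longrightarrow> maj_on (m \<star> ?g) a b"
          if "x \<in> insert ab S" for x
        proof (clarify)
          fix a b assume x: "x = (a, b)" and r: "rigid a b" and h: "has_maj a b"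
          have "maj_on m a b \<or> maj_on ?g a b" using x that m(3) r h ab g0 by blast
          then show "maj_on (m \<star> ?g) a b" using cyc_comp_maj(2) m(1,2) g r by blast
        qed
      qed
    qed
  qed
  obtain m where m: "pol3 m" "\<And>a b. rigid a b \<Longrightarrow> maj_on m a b \<or> proj_on m a b"
      "\<And>a b. rigid a b \<Longrightarrow> has_maj a b \<Longrightarrow> maj_on m a b"
    using mm[of "D \<times> D"] finite_D unfolding rigid_def by fast
  have p: "pol3 (m \<star> m)" "pol3 (m \<star> m \<star> m)" using pol3_cyc_comp m(1) by blast+
  show ?thesis
  proof (intro exI[of _ "m \<star> m \<star> m"] conjI allI impI)
    fix a b assume r: "rigid a b"
    show "if has_maj a b then maj_on (m \<star> m \<star> m) a b else fst_on (m \<star> m \<star> m) a b"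
    proof (cases "has_maj a b")
      case True
      then have "maj_on m a b" using m(3) r by blast
      then have "maj_on (m \<star> m \<star> m) a b" using cyc_comp_maj(2) m(1) p(1) r by blast
      then show ?thesis using True by simp
    next
      case False
      then have "proj_on m a b" using m(1,2) r unfolding has_maj_def by blast
      then show ?thesis using False cyc_comp_cube m(1) r by simp
    qed
  qed (rule p(2))
qed

text \<open>On a pair without majority no polymorphism has a Pixley type, since
  \<open>pixley_to_maj\<close> would turn it into majority. Only minority and projections remain
  there, so minorities accumulate under \<open>\<star>\<close> without normalisation.\<close>

lemma uniform_min:
  assumes dich: "\<And>a b. rigid a b \<Longrightarrow> has_maj a b \<or> (\<exists>f. pol3 f \<and> min_on f a b)"
  shows "\<exists>d. pol3 d \<and> (\<forall>a b. rigid a b \<longrightarrow> \<not> has_maj a b \<longrightarrow> min_on d a b)"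
proof -
  have mp: "min_on f a b \<or> proj_on f a b" if "pol3 f" "rigid a b" "\<not> has_maj a b" for f a b
    using pixley_to_maj_on[OF that(2,1)] pol3_pixley_to_maj[OF that(1)] that(3)
    unfolding has_maj_def by metis
  have "\<exists>d. pol3 d \<and> (\<forall>(a, b)\<in>S. rigid a b \<longrightarrow> \<not> has_maj a b \<longrightarrow> min_on d a b)"
    if "finite S" for S
    using that
  proof (induction S)
    case empty
    then show ?case using pol3_proj(1) by blast
  next
    case (insert ab S)
    then obtain d where d: "pol3 d"
      "\<And>a b. (a, b) \<in> S \<Longrightarrow> rigid a b \<Longrightarrow> \<not> has_maj a b \<Longrightarrow> min_on d a b" by blast
    obtain a0 b0 where ab: "ab = (a0, b0)" by (cases ab)
    show ?case
    proof (cases "rigid a0 b0 \<and> \<not> has_maj a0 b0")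
      case False
      then show ?thesis using d ab by (intro exI[of _ d]) auto
    next
      case True
      then obtain f where f: "pol3 f" "min_on f a0 b0" using dich by blast
      have "min_on (d \<star> f) a b" if "(a, b) \<in> insert ab S" "rigid a b" "\<not> has_maj a b" for a b
      proof (rule cyc_comp_min[OF mp[OF f(1) that(2,3)] mp[OF d(1) that(2,3)] _ that(2) d(1) f(1)])
        show "min_on d a b \<or> min_on f a b"
          using that(1) ab f(2) d(2)[OF _ that(2,3)] by blast
      qed
      then show ?thesis using pol3_cyc_comp[OF d(1) f(1)] by blast
    qed
  qed
  from this[of "D \<times> D"] show ?thesis using finite_D unfolding rigid_def by blast
qed

section \<open>The Siggers identity on rigid pairs\<close>

definition pol6 :: "('a \<Rightarrow> 'a \<Rightarrow> 'a \<Rightarrow> 'a \<Rightarrow> 'a \<Rightarrow> 'a \<Rightarrow> 'a) \<Rightarrow> bool" where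
  "pol6 s \<longleftrightarrow>
    (\<forall>a\<in>D. \<forall>b\<in>D. \<forall>c\<in>D. \<forall>d\<in>D. \<forall>e\<in>D. \<forall>f\<in>D. s a b c d e f \<in> {a, b, c, d, e, f}) \<and>
    (\<forall>a b c d e f a' b' c' d' e' f' a'' b'' c'' d'' e'' f''.
      R a a' a'' \<longrightarrow> R b b' b'' \<longrightarrow> R c c' c'' \<longrightarrow> R d d' d'' \<longrightarrow> R e e' e'' \<longrightarrow> R f f' f'' \<longrightarrow>
      R (s a b c d e f) (s a' b' c' d' e' f') (s a'' b'' c'' d'' e'' f''))"

lemma pol6_cons:
  assumes "pol6 s" "x \<in> D" "y \<in> D" "z \<in> D" "{a, b, c, d, e, f} \<subseteq> {x, y, z}"
  shows "s a b c d e f \<in> {x, y, z}"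
proof -
  have "a \<in> D" "b \<in> D" "c \<in> D" "d \<in> D" "e \<in> D" "f \<in> D" using assms by auto
  then have "s a b c d e f \<in> {a, b, c, d, e, f}" using assms(1) unfolding pol6_def by simp
  then show ?thesis using assms(5) by blast
qed

lemma pol6_R:
  assumes "pol6 s" "R a a' a''" "R b b' b''" "R c c' c''" "R d d' d''" "R e e' e''" "R f f' f''"
  shows "R (s a b c d e f) (s a' b' c' d' e' f') (s a'' b'' c'' d'' e'' f'')"
  using assms unfolding pol6_def by simp

text \<open>If both alternatives fail, every ternary polymorphism is a projection on the pair. The
  identity rules this out for suitable ternary minors of \<open>s\<close>.\<close>

lemma siggers_dichotomy:
  assumes s: "pol6 s"
    and sig: "\<And>x y z. x \<in> D \<Longrightarrow> y \<in> D \<Longrightarrow> z \<in> D \<Longrightarrow> s x x y y z z = s y z x z x y"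
    and r: "rigid a b"
  shows "has_maj a b \<or> (\<exists>f. pol3 f \<and> min_on f a b)"
proof (rule ccontr)
  assume no: "\<not> ?thesis"
  have pr: "proj_on f a b" if "pol3 f" for f
    using pixley_to_maj_on[OF r that] pol3_pixley_to_maj[OF that] that no
    unfolding has_maj_def by blast
  have ab: "a \<in> D" "b \<in> D" "a \<noteq> b" using r unfolding rigid_def by auto
  \<comment> \<open>The first minor is the left side of the identity, with blocks of positions 12,
    34, 56. Each further minor keeps one of these blocks and groups the positions 35, 16 or 24 that
    hold the same variable on the right side. These two blocks are disjoint, so no projection
    depends on both.\<close>
  have p: "pol3 (\<lambda>x y z. s x x y y z z)" "pol3 (\<lambda>x y z. s x x y z y z)"
    "pol3 (\<lambda>x y z. s y z x x z y)" "pol3 (\<lambda>x y z. s z y z y x x)"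
    unfolding pol3_def
    by (intro conjI ballI allI impI pol6_R[OF s]; (assumption | intro pol6_cons[OF s]; simp))+
  note sab = sig[OF ab(1,1,2)] sig[OF ab(1,2,1)] sig[OF ab(2,1,1)]
    sig[OF ab(2,2,1)] sig[OF ab(2,1,2)] sig[OF ab(1,2,2)]
  show False
    using pr[OF p(1)] pr[OF p(2)] pr[OF p(3)] pr[OF p(4)] ab(3) sab
    unfolding proj_on_def fst_on_def by (elim disjE conjE; simp)
qed

end


section \<open>Pairs coloured as semilattice, majority or affine\<close>

locale edge_coloured_triples = symmetric_triples +
  fixes v :: "'a \<Rightarrow> 'a \<Rightarrow> 'a" and m d :: "'a \<Rightarrow> 'a \<Rightarrow> 'a \<Rightarrow> 'a"
  assumes pol_v: "pol2 v" and pol_m: "pol3 m" and pol_d: "pol3 d"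
    and edge_types: "a \<in> D \<Longrightarrow> b \<in> D \<Longrightarrow> a \<noteq> b \<Longrightarrow> v a b = v b a \<or>
      v a b = a \<and> v b a = b \<and> (maj_on m a b \<or> fst_on m a b \<and> min_on d a b)"
begin

text \<open>The type refers to operations preserving \<open>R\<close> itself, so absence of affine
  edges in the binarisation does not directly exclude such pairs.\<close>

definition aff :: "'a \<Rightarrow> 'a \<Rightarrow> bool" where
  "aff a b \<longleftrightarrow> a \<in> D \<and> b \<in> D \<and> a \<noteq> b \<and> v a b = a \<and> v b a = b \<and> fst_on m a b \<and> min_on d a b"

lemma aff_sym: "aff a b \<Longrightarrow> aff b a"
  unfolding aff_def fst_on_def min_on_def by blast

lemma aff_d:
  assumes "aff a b"
  shows "d a a b = b" "d a b a = b" "d b a a = b" "d a b b = a" "d b a b = a" "d b b a = a"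
  using assms unfolding aff_def min_on_def by auto

lemma d_idem: "a \<in> D \<Longrightarrow> d a a a = a"
  using pol3_idem pol_d by blast

lemma v_idem: "a \<in> D \<Longrightarrow> v a a = a"
  using pol2_cases pol_v by blast

lemma m_idem: "a \<in> D \<Longrightarrow> m a a a = a"
  using pol3_idem pol_m by blast

lemmas v_R = pol2_R[OF pol_v]
lemmas m_R = pol3_R[OF pol_m]
lemmas d_R = pol3_R[OF pol_d]

section \<open>Affine cubes\<close>

text \<open>On semilattice edges \<open>k\<close> is \<open>v\<close>, on majority edges the first and on affine edges
  the second projection.\<close>

definition k :: "'a \<Rightarrow> 'a \<Rightarrow> 'a" where
  "k x y = m (v y x) (v x y) (v x y)"

lemma k_R: "R x y z \<Longrightarrow> R x' y' z' \<Longrightarrow> R (k x x') (k y y') (k z z')"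
  unfolding k_def by (intro m_R v_R)

lemma k_idem: "a \<in> D \<Longrightarrow> k a a = a"
  by (simp add: k_def v_idem m_idem)

lemma k_aff: "aff a b \<Longrightarrow> k a b = b"
  by (simp add: k_def aff_def fst_on_def)

lemma v_in: "a \<in> D \<Longrightarrow> b \<in> D \<Longrightarrow> v a b \<in> D"
  using pol2_cases[OF pol_v] by metis

lemma k_cases:
  assumes "q \<in> D" "p \<in> D"
  shows "k q p = q \<or> aff p q \<or> v p q = p \<and> v q p = p \<and> k q p = p"
proof (cases "q = p")
  case True
  then show ?thesis using k_idem assms by simp
next
  case False
  show ?thesis
  proof (cases "v q p = v p q")
    case True
    then show ?thesis using pol2_cases[OF pol_v assms] m_idem assms v_in by (auto simp: k_def)
  next
    case ne: False
    then have e: "v q p = q" "v p q = p" "maj_on m q p \<or> fst_on m q p \<and> min_on d q p"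
      using edge_types[OF assms False] by auto
    show ?thesis
    proof (cases "maj_on m q p")
      case True
      then show ?thesis by (simp add: k_def e maj_on_def)
    next
      case False
      then have "aff q p" using e ne assms unfolding aff_def by auto
      then show ?thesis using aff_sym by blast
    qed
  qed
qed

text \<open>Three neighbours of a missing vertex. By \<open>cube_far\<close> and
  \<open>cube_flip\<close>, up to symmetry, \<open>R\<close> meets the product of the three pairs
  exactly in the vertices that differ from \<open>(p, q, r)\<close> in an odd number of
  coordinates.\<close>

definition cube :: "'a \<Rightarrow> 'a \<Rightarrow> 'a \<Rightarrow> 'a \<Rightarrow> 'a \<Rightarrow> 'a \<Rightarrow> bool" where
  "cube p a q b r c \<longleftrightarrow> aff p a \<and> aff q b \<and> aff r c \<and>
    R a q r \<and> R p b r \<and> R p q c \<and> \<not> R p q r"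

lemma cube_swap12: "cube p a q b r c \<Longrightarrow> cube q b p a r c"
  unfolding cube_def using R_perms by blast

lemma cube_swap23: "cube p a q b r c \<Longrightarrow> cube p a r c q b"
  unfolding cube_def using R_perms by blast

text \<open>On affine pairs \<open>d\<close> is addition modulo 2, and the three neighbours of the
  missing vertex add up to the opposite one.\<close>

lemma cube_far:
  assumes "cube p a q b r c"
  shows "R a b c"
proof -
  have A: "aff p a" "aff q b" "aff r c" using assms unfolding cube_def by auto
  have "R (d a p p) (d q b q) (d r r c)"
    using assms unfolding cube_def by (intro d_R) auto
  then show ?thesis by (simp add: aff_d[OF A(1)] aff_d[OF A(2)] aff_d[OF A(3)])
qed

text \<open>If \<open>(p, b, c)\<close> were in \<open>R\<close>, adding \<open>(p, b, r)\<close>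
  and \<open>(p, q, c)\<close> by \<open>d\<close> would give the missing vertex.\<close>

lemma cube_flip:
  assumes "cube p a q b r c"
  shows "cube p a b q c r"
proof -
  have A: "aff p a" "aff q b" "aff r c" using assms unfolding cube_def by auto
  have D: "p \<in> D" using A unfolding aff_def by auto
  have C: "R p b r" "R p q c" "\<not> R p q r" using assms unfolding cube_def by auto
  have "\<not> R p b c"
  proof
    assume "R p b c"
    then have "R (d p p p) (d b b q) (d c r c)" using C by (intro d_R)
    then show False using C(3) by (simp add: aff_d[OF A(2)] aff_d[OF A(3)] d_idem D)
  qed
  then show ?thesis
    using C cube_far[OF assms] aff_sym A unfolding cube_def by blast
qed

text \<open>Otherwise \<open>k\<close> would map \<open>(a, q, r)\<close> and the 1-cycle \<open>(p, p, p)\<close> to \<open>(p, q, r)\<close>.\<close>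

lemma cube_vertex:
  assumes "cube p a q b r c"
  shows "k q p \<noteq> q \<or> k r p \<noteq> r"
proof (rule ccontr)
  assume k: "\<not> ?thesis"
  have C: "aff p a" "R a q r" "\<not> R p q r" using assms unfolding cube_def by auto
  then have "R (k a p) (k q p) (k r p)"
    using R_refl unfolding aff_def by (intro k_R) auto
  then show False using k_aff[OF aff_sym[OF C(1)]] C(3) k by simp
qed

text \<open>\<open>cube_vertex\<close> at two corners makes \<open>{r, p}\<close> affine. Then
  \<open>p\<close> can replace \<open>c\<close>, with the 1-cycle at \<open>p\<close> as third
  neighbour, and \<open>d\<close> applied to permutations of \<open>(a, a, p)\<close> and a 1-cycle
  reaches the vertex \<open>(a, p, p)\<close> of the new cube, which must be missing.\<close>

lemma no_cube_same_pair: "\<not> cube p a p a r c"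
proof
  assume c: "cube p a p a r c"
  have C: "aff p a" "aff r c" "R a p r" "R p a r" "\<not> R p p r"
    using c unfolding cube_def by auto
  have D: "p \<in> D" "r \<in> D" "a \<in> D" using C unfolding aff_def by auto
  have "k r p \<noteq> r" using cube_vertex[OF c] k_idem[OF D(1)] by blast
  moreover have "k p r \<noteq> p"
    using cube_vertex[OF cube_swap12[OF cube_swap23[OF c]]] by blast
  ultimately have pr: "aff r p"
    using k_cases[OF D(1,2)] k_cases[OF D(2,1)] aff_sym by metis
  then have c2: "cube p a p a r p"
    using C D R_refl unfolding cube_def by blast
  have "cube a p p a p r"
    using cube_swap12[OF cube_flip[OF cube_swap12[OF c2]]] .
  then have "\<not> R a p p" and aap: "R a a p" using cube_far[OF c2] unfolding cube_def by auto
  have "R (d a a a) (d a p a) (d p a a)"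
    by (rule d_R[OF aap R_perms(1)[OF aap] R_refl[OF D(3)]])
  then show False using \<open>\<not> R a p p\<close> by (simp add: aff_d[OF C(1)] d_idem D)
qed

text \<open>Otherwise \<open>k\<close> sends \<open>(a, q, r)\<close> and the 1-cycle at
  \<open>p\<close> to \<open>(p, p, r)\<close>. So \<open>p\<close> can replace \<open>b\<close>,
  and flipping yields a cube using the pair \<open>{p, a}\<close> twice.\<close>

lemma cube_affine_vertex:
  assumes c: "cube p a q b r c" and pq: "aff p q"
  shows "k r p \<noteq> r"
proof
  assume k: "k r p = r"
  have C: "aff p a" "aff q b" "aff r c" "R a q r" "R p b r" "R p q c" "\<not> R p q r"
    using c unfolding cube_def by auto
  have D: "p \<in> D" "r \<in> D" "a \<in> D" using C unfolding aff_def by auto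
  have "R (k a p) (k q p) (k r p)" using C D R_refl by (intro k_R) auto
  then have ppr: "R p p r" using k k_aff[OF aff_sym[OF C(1)]] k_aff[OF aff_sym[OF pq]] by simp
  then have c2: "cube p a q p r c" using C pq aff_sym unfolding cube_def by blast
  have "cube p a p q c r" using cube_flip[OF c2] .
  then have "\<not> R p p c" unfolding cube_def by blast
  moreover have "R a p c" using cube_far[OF c2] .
  moreover have "R p a c" using \<open>R a p c\<close> R_perms by blast
  ultimately have "cube p a p a c r" using C ppr aff_sym unfolding cube_def by blast
  then show False using no_cube_same_pair by blast
qed

text \<open>One affine pair forces the other two through \<open>cube_affine_vertex\<close>. With no
  affine pair, \<open>cube_vertex\<close> at the three corners forces a cyclic triple of semilattice
  edges, which \<open>acyclic\<close> refutes.\<close>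

lemma cube_all_aff:
  assumes c: "cube p a q b r c"
  shows "aff p q \<and> aff q r \<and> aff p r"
proof -
  have C: "aff p a" "aff q b" "aff r c" "R a q r" "R p b r" "R p q c" "\<not> R p q r"
    using c unfolding cube_def by auto
  have D: "p \<in> D" "q \<in> D" "r \<in> D" "a \<in> D" using C unfolding aff_def by auto
  \<comment> \<open>The 1-cycle at \<open>p\<close> leads from \<open>(a, q, r)\<close> to
    \<open>(a, q, p)\<close> by \<open>v\<close> and on to \<open>(p, q, p)\<close> by
    \<open>k\<close>; \<open>v\<close> then combines \<open>(p, p, q)\<close> with
    \<open>(a, q, r)\<close> to the missing vertex.\<close>
  have acyclic: False
    if c: "cube p a q b r c" and "v p q = q" "v q p = q" "v q r = r" "v r p = p"
    for p q r a b c
  proof -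
    have C: "aff p a" "R a q r" "\<not> R p q r" "p \<in> D" "v p a = p" "v a p = a" "q \<in> D"
      using c unfolding cube_def aff_def by auto
    have "R (v a p) (v q p) (v r p)"
      using C R_refl by (intro v_R) auto
    then have "R a q p" using C that by auto
    have "R (k a p) (k q p) (k p p)"
      using C R_refl \<open>R a q p\<close> by (intro k_R) auto
    moreover have "k q p = q" using that C by (simp add: k_def m_idem)
    ultimately have "R p q p" using k_aff[OF aff_sym[OF C(1)]] k_idem C by simp
    then have "R (v p a) (v p q) (v q r)" by (rule v_R[OF R_perms(1) C(2)])
    then show False using C that by simp
  qed
  have one: "aff p q \<and> aff q r \<and> aff p r" if c: "cube p a q b r c" and pq: "aff p q"
    for p q r a b c
  proof -
    have D: "p \<in> D" "q \<in> D" "r \<in> D" using c unfolding cube_def aff_def by auto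
    have pr: "k r p \<noteq> r" using cube_affine_vertex[OF c pq] .
    have qr: "k r q \<noteq> r" using cube_affine_vertex[OF cube_swap12[OF c] aff_sym[OF pq]] .
    have rv: "k p r \<noteq> p \<or> k q r \<noteq> q"
      using cube_vertex[OF cube_swap12[OF cube_swap23[OF c]]] by blast
    have p_or: "aff p r \<or> k p r = p" "aff q r \<or> k q r = q"
      using k_cases[OF D(3,1)] k_cases[OF D(3,2)] k_cases[OF D(1,3)] k_cases[OF D(2,3)]
        pr qr aff_sym D by metis+
    have x: "aff p r \<Longrightarrow> k q r \<noteq> q"
      using cube_affine_vertex[OF cube_swap12[OF cube_swap23[OF c]] aff_sym] .
    have y: "aff q r \<Longrightarrow> k p r \<noteq> p"
      using cube_affine_vertex[OF cube_swap12[OF cube_swap23[OF cube_swap12[OF c]]] aff_sym] .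
    show ?thesis using p_or x y rv pq by blast
  qed
  have c': "cube q b r c p a" "cube p a r c q b" "cube r c p a q b"
    using c cube_swap12 cube_swap23 by blast+
  have vs: "k q p \<noteq> q \<or> k r p \<noteq> r" "k r q \<noteq> r \<or> k p q \<noteq> p" "k p r \<noteq> p \<or> k q r \<noteq> q"
    using cube_vertex[OF c] cube_vertex[OF c'(1)] cube_vertex[OF c'(3)] by blast+
  consider "aff p q" | "aff q r" | "aff p r" | "\<not> aff p q" "\<not> aff q r" "\<not> aff p r" by blast
  then show ?thesis
  proof cases
    case 4
    have "v p q = q \<and> v q p = q \<and> v q r = r \<and> v r p = p \<or>
      v q p = p \<and> v p q = p \<and> v r q = q \<and> v p r = r \<and> v r p = r"
      using vs 4 aff_sym k_cases[OF D(1,2)] k_cases[OF D(2,1)] k_cases[OF D(1,3)]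
        k_cases[OF D(3,1)] k_cases[OF D(2,3)] k_cases[OF D(3,2)] by metis
    then show ?thesis using acyclic[OF c] acyclic[OF c'(2)] by blast
  qed (use one[OF c] one[OF c'(1)] one[OF c'(2)] aff_sym in blast)+
qed

text \<open>If \<open>(x, x, y)\<close> is missing, so is \<open>(x, y, y)\<close> by
  \<open>type\<close>. This forces \<open>d z x y = z\<close>, which brings in
  \<open>(x, x, z)\<close> and \<open>(x, z, z)\<close>; adding these to \<open>(x, y, z)\<close>
  gives the missing triple.\<close>

lemma aff_triangle:
  assumes R: "R x y z" and A: "aff x y" "aff y z" "aff x z"
  shows "R x x y"
proof (rule ccontr)
  assume no: "\<not> R x x y"
  have D: "x \<in> D" "y \<in> D" "z \<in> D" using A unfolding aff_def by auto
  note [simp] = aff_d[OF A(1)] aff_d[OF A(2)] aff_d[OF A(3)] d_idem[OF D(1)] d_idem[OF D(2)]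
    d_idem[OF D(3)]
  have type: "R s s t" if "R s t t" "aff s t" for s t
  proof -
    have "s \<in> D" "t \<in> D" using that(2) unfolding aff_def by auto
    have "R (d s t t) (d t s t) (d t t t)"
      by (rule d_R[OF that(1) R_perms(2)[OF that(1)] R_refl[OF \<open>t \<in> D\<close>]])
    then show ?thesis using that(2) by (simp add: aff_d d_idem \<open>t \<in> D\<close>)
  qed
  have "\<not> R y y x" using no type[of x y] A R_perms by blast
  have dz: "d z x y = z"
  proof -
    have "R (d x x y) (d y x y) (d z x y)" by (rule d_R[OF R R_refl[OF D(1)] R_refl[OF D(2)]])
    then have "R y x (d z x y)" by simp
    then show ?thesis using pol3_cases[OF pol_d D(3,1,2)] no \<open>\<not> R y y x\<close> R_perms by metis
  qed
  have xxz: "R x x z"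
  proof (rule ccontr)
    assume no': "\<not> R x x z"
    then have "\<not> R z z x" using type[of x z] A R_perms by blast
    have "R (d z x x) (d z x z) (d z x y)"
      by (rule d_R[OF R_refl[OF D(3)] R_refl[OF D(1)] R_perms(1)[OF R]])
    then have "R z x z \<or> R z x x" using dz by simp
    then show False using no' \<open>\<not> R z z x\<close> R_perms by blast
  qed
  have "R (d x x x) (d x z x) (d z x x)"
    by (rule d_R[OF xxz R_perms(1)[OF xxz] R_refl[OF D(1)]])
  then have "R x z z" by simp
  then have "R (d x x x) (d y z z) (d z z x)" by (rule d_R[OF R _ R_perms(1)[OF xxz]])
  then show False using no R_perms(1) by simp
qed

text \<open>Flipped cubes have affine vertices too, so \<open>aff_triangle\<close> applies to
  \<open>(p, q, c)\<close> and \<open>(p, b, r)\<close>. The resulting triples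
  \<open>(p, q, p)\<close> and \<open>(p, p, r)\<close> and the 1-cycle at \<open>p\<close> add up
  to \<open>(p, q, r)\<close>.\<close>

lemma no_cube: "\<not> cube p a q b r c"
proof
  assume c: "cube p a q b r c"
  then have C: "aff p a" "aff q b" "aff r c" "R a q r" "R p b r" "R p q c" "\<not> R p q r"
    unfolding cube_def by auto
  have A: "aff p q" "aff q r" "aff p r" using cube_all_aff[OF c] by auto
  have c1: "cube p a b q c r" using cube_flip[OF c] .
  have c2: "cube a p q b c r" using cube_swap12[OF cube_flip[OF cube_swap12[OF c]]] .
  have c3: "cube a p b q r c"
    using cube_swap23[OF cube_swap12[OF cube_flip[OF cube_swap12[OF cube_swap23[OF c]]]]] .
  have D: "p \<in> D" "q \<in> D" "r \<in> D" using A unfolding aff_def by auto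
  have B: "aff q c" "aff p c" "aff r b" "aff p b"
    using cube_all_aff[OF c1] cube_all_aff[OF c2] cube_all_aff[OF c3] aff_sym by auto
  have "R p q p" using R_perms(1)[OF aff_triangle[OF C(6) A(1) B(1,2)]] .
  moreover have "R p p r" using aff_triangle[OF R_perms(1)[OF C(5)] A(3) B(3,4)] .
  ultimately have "R (d p p p) (d q p p) (d p p r)" using R_refl[OF D(1)] by (intro d_R)
  then show False using C(7) by (simp add: d_idem D aff_d[OF A(1)] aff_d[OF A(3)])
qed

section \<open>Triples that can be corrected in each coordinate\<close>

lemma R_semilattice:
  assumes "R a q r" "R p b r" "v p a = p" "v a p = p" "v q b = q"
  shows "R p q r"
proof -
  have "R (v a p) (v q b) (v r r)" by (rule v_R[OF assms(1,2)])
  moreover have "v r r = r" using R_in[OF assms(1)] v_idem by blast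
  ultimately show ?thesis using assms(4,5) by simp
qed

lemma R_decomposable:
  assumes R: "R a q r" "R p b r" "R p q c" and v: "v p a = p" "v q b = q" "v r c = r"
  shows "R p q r"
proof (rule ccontr)
  assume no: "\<not> R p q r"
  have D: "p \<in> D" "a \<in> D" "q \<in> D" "b \<in> D" "r \<in> D" "c \<in> D"
    using R_in[OF R(1)] R_in[OF R(2)] R_in[OF R(3)] by auto
  have ne: "p \<noteq> a" "q \<noteq> b" "r \<noteq> c" using no R by auto
  have "v a p \<noteq> p" using no R_semilattice[OF R(1,2)] v by blast
  moreover have "v b q \<noteq> q"
    using no R_semilattice[OF R_perms(2)[OF R(2)] R_perms(2)[OF R(1)] v(2) _ v(1)] R_perms(2)
    by blast
  moreover have "v c r \<noteq> r"
    using no R_semilattice[OF R_perms(4)[OF R(3)] R_perms(4)[OF R(1)] v(3) _ v(1)] R_perms(3)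
    by blast
  ultimately have e: "maj_on m p a \<or> aff p a" "maj_on m q b \<or> aff q b" "maj_on m r c \<or> aff r c"
    using edge_types[OF D(1,2) ne(1)] edge_types[OF D(3,4) ne(2)] edge_types[OF D(5,6) ne(3)]
      v D ne unfolding aff_def by auto
  \<comment> \<open>In a majority coordinate, \<open>m\<close> outvotes the correction wherever it
    stands. The row correcting that coordinate goes first, so the other coordinates start with the
    right entry and either type of \<open>m\<close> returns it.\<close>
  note mm = maj_on_def fst_on_def aff_def
  have "\<not> maj_on m p a"
    using no e(2,3) m_R[OF R] unfolding mm by auto
  moreover have "\<not> maj_on m q b"
    using no e(1,3) m_R[OF R(2) R(1) R(3)] unfolding mm by auto
  moreover have "\<not> maj_on m r c"
    using no e(1,2) m_R[OF R(3) R(1) R(2)] unfolding mm by auto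
  ultimately have "cube p a q b r c" using e R no unfolding cube_def by blast
  then show False using no_cube by blast
qed

section \<open>Cyclic triples of semilattice edges\<close>

text \<open>A rock-paper-scissors pattern: \<open>a\<close> beats \<open>p\<close>, \<open>b\<close>
  beats \<open>a\<close>, and \<open>p\<close> beats \<open>b\<close>. The entry \<open>p\<close> is
  meant as the value of the column.\<close>

definition three_cycle :: "'a \<Rightarrow> 'a \<Rightarrow> 'a \<Rightarrow> bool" where
  "three_cycle p a b \<longleftrightarrow> p \<in> D \<and> a \<in> D \<and> b \<in> D \<and> v p a = a \<and> v a p = a \<and>
    v a b = b \<and> v b a = b \<and> v b p = p \<and> v p b = p"

definition absorbing :: "'a \<Rightarrow> 'a set \<Rightarrow> bool" where
  "absorbing p X \<longleftrightarrow> p \<in> D \<and> (\<forall>s\<in>X. v p s = p)"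

lemma three_cycle_v:
  assumes "three_cycle p a b"
  shows "v p p = p" "v a a = a" "v b b = b" "v p a = a" "v a p = a" "v a b = b" "v b a = b"
    "v b p = p" "v p b = p"
  using assms v_idem unfolding three_cycle_def by auto

text \<open>A correction \<open>b\<close> is beaten by \<open>p\<close> and is absorbed by
  \<open>v\<close>. A correction \<open>a\<close> is first moved to \<open>b\<close> by the row
  through \<open>b\<close>, which leaves \<open>q\<close> and \<open>r\<close> in place.\<close>

lemma decomposable_one_cycle:
  assumes X: "three_cycle p a b" and Y: "absorbing q Y" and Z: "absorbing r Z"
    and "\<alpha> \<in> {p, a, b}" "R \<alpha> q r" "\<beta> \<in> Y" "R p \<beta> r" "y \<in> Y" "z \<in> Z" "R b y z"
  shows "R p q r"
proof -
  note [simp] = three_cycle_v[OF X]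
  have e [simp]: "v q \<beta> = q" "v q y = q" "v r z = r" using assms unfolding absorbing_def by auto
  have b: "R p q r" if "R b q r" using R_semilattice[OF that \<open>R p \<beta> r\<close>] by simp
  have "R b q r" if "R a q r" using v_R[OF that \<open>R b y z\<close>] by simp
  then show ?thesis using b assms by blast
qed

text \<open>A correction \<open>b\<close> or \<open>h\<close> is absorbed using
  \<open>(p, q, \<gamma>)\<close>. For \<open>a\<close> and \<open>c\<close>, \<open>v\<close> forms
  \<open>(a, c, r)\<close>, the rows through \<open>b\<close> and \<open>h\<close> drive it to
  \<open>(b, h, r)\<close>, and \<open>(p, c, r)\<close> turns that into
  \<open>(p, h, r)\<close>.\<close>

lemma decomposable_two_cycles:
  assumes X: "three_cycle p a b" and Y: "three_cycle q c h" and Z: "absorbing r Z"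
    and "\<alpha> \<in> {p, a, b}" "R \<alpha> q r" "\<beta> \<in> {q, c, h}" "R p \<beta> r" "\<gamma> \<in> Z" "R p q \<gamma>"
    and "y \<in> {q, c, h}" "z \<in> Z" "R b y z" and "x \<in> {p, a, b}" "z' \<in> Z" "R x h z'"
  shows "R p q r"
proof -
  have "r \<in> D" using Z unfolding absorbing_def by blast
  note [simp] = three_cycle_v[OF X] three_cycle_v[OF Y] v_idem[OF \<open>r \<in> D\<close>]
  have e [simp]: "v r \<gamma> = r" "v r z = r" "v r z' = r" using assms unfolding absorbing_def by auto
  have b: "R p q r" if "R b q r" using v_R[OF that \<open>R p q \<gamma>\<close>] by simp
  have h: "R p q r" if "R p h r" using v_R[OF that \<open>R p q \<gamma>\<close>] by simp
  have "R p q r" if A: "R a q r" "R p c r"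
  proof -
    have acr: "R a c r" using v_R[OF A] by simp
    have "R b c r \<or> R b h r" using v_R[OF acr \<open>R b y z\<close>] \<open>y \<in> {q, c, h}\<close> by auto
    moreover have "R a h r \<or> R b h r" using v_R[OF acr \<open>R x h z'\<close>] \<open>x \<in> {p, a, b}\<close> by auto
    moreover have "R b h r" if "R b c r" "R a h r" using v_R[OF that] by simp
    ultimately have bdr: "R b h r" by blast
    show ?thesis using h v_R[OF bdr A(2)] by simp
  qed
  then show ?thesis using b h assms by blast
qed

text \<open>From \<open>(p, c, e)\<close> the rows through \<open>h\<close> and \<open>f\<close>
  lead to \<open>(p, h, f)\<close> or \<open>(a, h, f)\<close>. The former is absorbed with
  \<open>(b, q, r)\<close>; the latter needs a further walk around the cycles.\<close>

lemma decomposable_three_cycles_mixed: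
  assumes X: "three_cycle p a b" and Y: "three_cycle q c h" and Z: "three_cycle r e f"
    and R: "R b q r" "R p c r" "R p q e"
    and y: "x \<in> {p, a, b}" "z \<in> {r, e, f}" "R x h z"
    and z: "x' \<in> {p, a, b}" "y' \<in> {q, c, h}" "R x' y' f"
  shows "R p q r"
proof -
  note [simp] = three_cycle_v[OF X] three_cycle_v[OF Y] three_cycle_v[OF Z]
  have pce: "R p c e" using v_R[OF R(2,3)] by simp
  have pdf: "R p q r" if "R p h f" using v_R[OF that R(1)] by simp
  have 1: "R p h e \<or> R p h f \<or> R a h e \<or> R a h f"
    using v_R[OF y(3) pce] y(1,2) by auto
  have 2: "R p c f \<or> R p h f \<or> R a c f \<or> R a h f"
    using v_R[OF z(3) pce] z(1,2) by auto
  have "R p h f" if "R p h e" "R p c f" using v_R[OF that] by simp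
  moreover have "R a h f" if "R p h e" "R a c f" using v_R[OF that] by simp
  moreover have "R a h f" if "R a h e" "R p c f" using v_R[OF that] by simp
  moreover have "R a h f" if "R a h e" "R a c f" using v_R[OF that] by simp
  ultimately consider "R p h f" | "R a h f" using 1 2 by blast
  then show ?thesis
  proof cases
    case 2
    have "R a q f" using v_R[OF 2 R(3)] by simp
    then have "R a c r" using v_R[OF _ R(2)] by fastforce
    then have "R b c r" using v_R[OF _ R(1)] by fastforce
    then have "R b h r" using v_R[OF _ 2] by fastforce
    then have "R p h r" using v_R[OF _ R(2)] by fastforce
    then show ?thesis using v_R[OF _ R(1)] by fastforce
  qed (rule pdf)
qed

text \<open>The cases count the corrections among \<open>b\<close>, \<open>h\<close>,
  \<open>f\<close>: two merge directly by \<open>v\<close>, one is the mixed case. If there is none,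
  \<open>v\<close> forms \<open>(a, c, e)\<close>, the given rows advance it to
  \<open>(b, h, f)\<close>, and going back yields two such corrections.\<close>

lemma decomposable_three_cycles:
  assumes X: "three_cycle p a b" and Y: "three_cycle q c h" and Z: "three_cycle r e f"
    and R: "\<alpha> \<in> {p, a, b}" "R \<alpha> q r" "\<beta> \<in> {q, c, h}" "R p \<beta> r" "\<gamma> \<in> {r, e, f}" "R p q \<gamma>"
    and x: "y \<in> {q, c, h}" "z \<in> {r, e, f}" "R b y z"
    and y: "x' \<in> {p, a, b}" "z' \<in> {r, e, f}" "R x' h z'"
    and z: "x'' \<in> {p, a, b}" "y'' \<in> {q, c, h}" "R x'' y'' f"
  shows "R p q r"
proof (rule ccontr)
  assume no: "\<not> R p q r"
  note [simp] = three_cycle_v[OF X] three_cycle_v[OF Y] three_cycle_v[OF Z]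
  have "\<not> (R b q r \<and> R p h r)" using no v_R[of b q r p h r] by auto
  moreover have "\<not> (R b q r \<and> R p q f)" using no v_R[of b q r p q f] by auto
  moreover have "\<not> (R p h r \<and> R p q f)" using no v_R[of p h r p q f] by auto
  moreover have "\<not> (R b q r \<and> R p c r \<and> R p q e)"
    using no decomposable_three_cycles_mixed[OF X Y Z _ _ _ y z] by blast
  moreover have "\<not> (R p h r \<and> R a q r \<and> R p q e)"
    using no decomposable_three_cycles_mixed[OF Y X Z _ _ _ x(1,2) R_perms(2)[OF x(3)]
        z(2,1) R_perms(2)[OF z(3)]] R_perms x by blast
  moreover have "\<not> (R p q f \<and> R a q r \<and> R p c r)"
    using no decomposable_three_cycles_mixed[OF Z X Y _ _ _ x(2,1) R_perms(4)[OF x(3)]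
        y(2,1) R_perms(4)[OF y(3)]] R_perms by blast
  moreover have False if A: "R a q r" "R p c r" "R p q e"
  proof -
    have acr: "R a c r" and aqe: "R a q e" and pce: "R p c e"
      using v_R[OF A(1,2)] v_R[OF A(1,3)] v_R[OF A(2,3)] by auto
    have ace: "R a c e" using v_R[OF acr A(3)] by simp
    have "R b (v q y) (v r z)" using v_R[OF A(1) x(3)] by simp
    then have bce: "R b c e" using v_R[OF _ ace] x(1,2) by fastforce
    have "R (v p x') h (v r z')" using v_R[OF A(2) y(3)] by simp
    then have ade: "R a h e" using v_R[OF _ ace] y(1,2) by fastforce
    have "R (v p x'') (v q y'') f" using v_R[OF A(3) z(3)] by simp
    then have acf: "R a c f" using v_R[OF _ ace] z(1,2) by fastforce
    have "R b h e" using v_R[OF bce ade] by simp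
    then have bhf: "R b h f" using v_R[OF _ acf] by fastforce
    have "R b q r" using v_R[OF bhf A(1)] by simp
    moreover have "R p h r" using v_R[OF bhf A(2)] by simp
    ultimately show False using no v_R[of b q r p h r] by auto
  qed
  ultimately show False using R no by blast
qed

definition absorbing_or_cycle :: "'a \<Rightarrow> 'a set \<Rightarrow> bool" where
  "absorbing_or_cycle p X \<longleftrightarrow> absorbing p X \<or> (\<exists>a b. three_cycle p a b \<and> X = {p, a, b})"

lemma R_decomposable_general:
  assumes "absorbing_or_cycle p X" "absorbing_or_cycle q Y" "absorbing_or_cycle r Z"
    and n: "\<exists>x\<in>X. R x q r" "\<exists>y\<in>Y. R p y r" "\<exists>z\<in>Z. R p q z"
    and x: "\<And>x. x \<in> X \<Longrightarrow> \<exists>y\<in>Y. \<exists>z\<in>Z. R x y z"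
    and y: "\<And>y. y \<in> Y \<Longrightarrow> \<exists>x\<in>X. \<exists>z\<in>Z. R x y z"
    and z: "\<And>z. z \<in> Z \<Longrightarrow> \<exists>x\<in>X. \<exists>y\<in>Y. R x y z"
  shows "R p q r"
proof -
  have one: "R p q r"
    if X: "three_cycle p a b" "X = {p, a, b}" and "absorbing q Y" "absorbing r Z"
      and "\<exists>x\<in>X. R x q r" "\<exists>y\<in>Y. R p y r" "\<And>x. x \<in> X \<Longrightarrow> \<exists>y\<in>Y. \<exists>z\<in>Z. R x y z"
    for p q r a b X Y Z
  proof -
    have "b \<in> X" using X(2) by blast
    from that(7)[OF this] that(5,6) show ?thesis
      using decomposable_one_cycle[OF X(1) that(3,4)] X(2) by blast
  qed
  have two: "R p q r"
    if X: "three_cycle p a b" "X = {p, a, b}" and Y: "three_cycle q c h" "Y = {q, c, h}"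
      and Z: "absorbing r Z"
      and n: "\<exists>x\<in>X. R x q r" "\<exists>y\<in>Y. R p y r" "\<exists>z\<in>Z. R p q z"
      and x: "\<And>x. x \<in> X \<Longrightarrow> \<exists>y\<in>Y. \<exists>z\<in>Z. R x y z"
      and y: "\<And>y. y \<in> Y \<Longrightarrow> \<exists>x\<in>X. \<exists>z\<in>Z. R x y z"
    for p q r a b c h X Y Z
  proof -
    have "b \<in> X" "h \<in> Y" using X(2) Y(2) by blast+
    obtain s t where 1: "s \<in> Y" "t \<in> Z" "R b s t" using x[OF \<open>b \<in> X\<close>] by blast
    obtain s' t' where 2: "s' \<in> X" "t' \<in> Z" "R s' h t'" using y[OF \<open>h \<in> Y\<close>] by blast
    show ?thesis
      using decomposable_two_cycles[OF X(1) Y(1) Z _ _ _ _ _ _ _ 1(2,3) _ 2(2,3)]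
        n 1(1) 2(1) X(2) Y(2) by blast
  qed
  \<comment> \<open>Permuted copies of the hypotheses let the total symmetry of \<open>R\<close>
    reduce the choice of cyclic columns to their number.\<close>
  have n12: "\<exists>y\<in>Y. R y p r" "\<exists>x\<in>X. R q x r" "\<exists>z\<in>Z. R q p z" using n R_perms by blast+
  have n13: "\<exists>z\<in>Z. R z p q" "\<exists>x\<in>X. R r x q" "\<exists>y\<in>Y. R r p y" using n R_perms by blast+
  have n23: "\<exists>x\<in>X. R x r q" "\<exists>z\<in>Z. R p z q" "\<exists>y\<in>Y. R p r y" using n R_perms by blast+
  have n123: "\<exists>y\<in>Y. R y r p" "\<exists>z\<in>Z. R q z p" "\<exists>x\<in>X. R q r x" using n R_perms by blast+
  have y12: "\<exists>x\<in>X. \<exists>z\<in>Z. R y x z" if "y \<in> Y" for y using y[OF that] R_perms by blast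
  have x12: "\<exists>y\<in>Y. \<exists>z\<in>Z. R y x z" if "x \<in> X" for x using x[OF that] R_perms by blast
  have z13: "\<exists>x\<in>X. \<exists>y\<in>Y. R z x y" if "z \<in> Z" for z using z[OF that] R_perms by blast
  have x23: "\<exists>z\<in>Z. \<exists>y\<in>Y. R x z y" if "x \<in> X" for x using x[OF that] R_perms by blast
  have z23: "\<exists>x\<in>X. \<exists>y\<in>Y. R x z y" if "z \<in> Z" for z using z[OF that] R_perms by blast
  have y123: "\<exists>z\<in>Z. \<exists>x\<in>X. R y z x" if "y \<in> Y" for y using y[OF that] R_perms by blast
  have z123: "\<exists>y\<in>Y. \<exists>x\<in>X. R y z x" if "z \<in> Z" for z using z[OF that] R_perms by blast
  consider
      (0) "absorbing p X" "absorbing q Y" "absorbing r Z"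
    | (cx) a b where "three_cycle p a b" "X = {p, a, b}" "absorbing q Y" "absorbing r Z"
    | (cy) c h where "three_cycle q c h" "Y = {q, c, h}" "absorbing p X" "absorbing r Z"
    | (cz) e f where "three_cycle r e f" "Z = {r, e, f}" "absorbing p X" "absorbing q Y"
    | (cxy) a b c h where "three_cycle p a b" "X = {p, a, b}" "three_cycle q c h" "Y = {q, c, h}"
        "absorbing r Z"
    | (cxz) a b e f where "three_cycle p a b" "X = {p, a, b}" "three_cycle r e f" "Z = {r, e, f}"
        "absorbing q Y"
    | (cyz) c h e f where "three_cycle q c h" "Y = {q, c, h}" "three_cycle r e f" "Z = {r, e, f}"
        "absorbing p X"
    | (cxyz) a b c h e f where "three_cycle p a b" "X = {p, a, b}" "three_cycle q c h"
        "Y = {q, c, h}" "three_cycle r e f" "Z = {r, e, f}"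
    using assms(1-3) unfolding absorbing_or_cycle_def by metis
  then show ?thesis
  proof cases
    case 0
    from n obtain s t w where "s \<in> X" "R s q r" "t \<in> Y" "R p t r" "w \<in> Z" "R p q w" by blast
    then show ?thesis using 0 R_decomposable unfolding absorbing_def by blast
  next
    case cx
    show ?thesis by (rule one[OF cx n(1,2) x])
  next
    case cy
    show ?thesis by (rule R_swap12[OF one[OF cy n12(1,2) y12]])
  next
    case cz
    show ?thesis by (rule R_perms(3)[OF one[OF cz n13(1,2) z13]])
  next
    case cxy
    show ?thesis by (rule two[OF cxy n x y])
  next
    case cxz
    show ?thesis by (rule R_swap23[OF two[OF cxz n23 x23 z23]])
  next
    case cyz
    show ?thesis by (rule R_perms(4)[OF two[OF cyz n123 y123 z123]])
  next
    case cxyz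
    have bhf: "b \<in> X" "h \<in> Y" "f \<in> Z" using cxyz by blast+
    obtain s t where 1: "s \<in> Y" "t \<in> Z" "R b s t" using x[OF bhf(1)] by blast
    obtain s' t' where 2: "s' \<in> X" "t' \<in> Z" "R s' h t'" using y[OF bhf(2)] by blast
    obtain s'' t'' where 3: "s'' \<in> X" "t'' \<in> Y" "R s'' t'' f" using z[OF bhf(3)] by blast
    obtain \<alpha> \<beta> \<gamma> where 4: "\<alpha> \<in> X" "R \<alpha> q r" "\<beta> \<in> Y" "R p \<beta> r" "\<gamma> \<in> Z" "R p q \<gamma>"
      using n by blast
    show ?thesis
      using 1 2 3 4 decomposable_three_cycles[OF cxyz(1,3,5)] cxyz(2,4,6) by simp
  qed
qed

section \<open>The value of the composed operation on one column\<close>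

lemma v_edge:
  assumes "a \<in> D" "b \<in> D"
  shows "v a b = b \<and> v b a = b \<or> v a b = a \<and> v b a = a \<or> v a b = a \<and> v b a = b"
proof (cases "a = b")
  case True
  then show ?thesis using v_idem assms by simp
next
  case False
  then show ?thesis using edge_types[OF assms] pol2_cases[OF pol_v assms] by auto
qed

text \<open>If \<open>p\<close> fails to absorb \<open>a\<close>, then \<open>a\<close> beats
  \<open>p\<close>. Without a cycle, the three inner values either all avoid \<open>p\<close>, or
  lie in \<open>{p, a}\<close> and include \<open>a\<close>. In both cases \<open>w\<close> cannot
  return \<open>p\<close>.\<close>

lemma absorbing_or_cycle_outcome:
  assumes D: "x \<in> D" "y \<in> D" "z \<in> D"
    and w: "\<And>s t r. s \<in> D \<Longrightarrow> t \<in> D \<Longrightarrow> r \<in> D \<Longrightarrow> w s t r \<in> {s, t, r}"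
    and w_edge: "\<And>a b s t r. a \<in> D \<Longrightarrow> b \<in> D \<Longrightarrow> a \<noteq> b \<Longrightarrow> v a b = v b a \<Longrightarrow>
      s \<in> {a, b} \<Longrightarrow> t \<in> {a, b} \<Longrightarrow> r \<in> {a, b} \<Longrightarrow> w s t r = v (v s t) r"
    and p: "p = w (v (v x y) z) (v (v y z) x) (v (v z x) y)"
  shows "absorbing_or_cycle p {x, y, z}"
proof (cases "absorbing p {x, y, z}")
  case True
  then show ?thesis unfolding absorbing_or_cycle_def by blast
next
  case False
  have g: "v (v x y) z \<in> {x, y, z}" "v (v y z) x \<in> {x, y, z}" "v (v z x) y \<in> {x, y, z}"
    using pol2_cases[OF pol_v] D by (metis insert_iff)+
  then have pX: "p \<in> {x, y, z}"
    using w[of "v (v x y) z" "v (v y z) x" "v (v z x) y"] D p by auto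
  then have pD: "p \<in> D" using D by auto
  with False obtain a where a: "a \<in> {x, y, z}" "v p a \<noteq> p" unfolding absorbing_def by blast
  then have aD: "a \<in> D" using D by auto
  have pa: "v p a = a" "v a p = a" using v_edge[OF pD aD] a(2) by auto
  have ne: "p \<noteq> a" using a v_idem pD by auto
  \<comment> \<open>\<open>b\<close> is the remaining entry of the column and may coincide with
    \<open>p\<close> or \<open>a\<close>.\<close>
  have "\<exists>b\<in>D. (x, y, z) \<in> {(p, a, b), (p, b, a), (a, p, b), (a, b, p), (b, p, a), (b, a, p)}"
    using pX a(1) ne D by (elim insertE emptyE; simp; blast)
  then obtain b where b: "b \<in> D"
    "(x, y, z) \<in> {(p, a, b), (p, b, a), (a, p, b), (a, b, p), (b, p, a), (b, a, p)}" by blast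
  have X: "{x, y, z} = {p, a, b}" using b(2) by (elim insertE emptyE) auto
  note [simp] = pa v_idem[OF pD] v_idem[OF aD] v_idem[OF b(1)]
  have w': "w s t r \<noteq> p"
    if "s \<noteq> p \<and> t \<noteq> p \<and> r \<noteq> p \<and> {s, t, r} \<subseteq> D \<or> {s, t, r} \<subseteq> {p, a} \<and> a \<in> {s, t, r}" for s t r
    using that
  proof
    assume "s \<noteq> p \<and> t \<noteq> p \<and> r \<noteq> p \<and> {s, t, r} \<subseteq> D"
    then show ?thesis using w[of s t r] by auto
  next
    assume s: "{s, t, r} \<subseteq> {p, a} \<and> a \<in> {s, t, r}"
    then have "w s t r = v (v s t) r" using w_edge[OF pD aD ne] by simp
    moreover have "s = p \<or> s = a" "t = p \<or> t = a" "r = p \<or> r = a" "s = a \<or> t = a \<or> r = a"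
      using s by auto
    then have "v (v s t) r = a" by (elim disjE) simp_all
    ultimately show ?thesis using ne by simp
  qed
  have "three_cycle p a b"
  proof (rule ccontr)
    assume no: "\<not> three_cycle p a b"
    let ?g = "v (v x y) z" and ?h = "v (v y z) x" and ?k = "v (v z x) y"
    have "?g \<noteq> p \<and> ?h \<noteq> p \<and> ?k \<noteq> p \<or> {?g, ?h, ?k} \<subseteq> {p, a} \<and> a \<in> {?g, ?h, ?k}"
    proof (cases "b = p \<or> b = a")
      case True
      then have "?g = a \<and> ?h = a \<and> ?k = a"
        using b(2) by (elim disjE insertE emptyE; simp)
      then show ?thesis using ne by simp
    next
      case False
      then have "v a b = b \<and> v b a = b \<and> v p b = b \<and> v b p = b \<or>
          v a b = b \<and> v b a = b \<and> v p b = p \<and> v b p = b \<or>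
          (v a b = a \<and> v b a = a \<or> v a b = a \<and> v b a = b) \<and>
          (v p b = b \<and> v b p = b \<or> v p b = p \<and> v b p = p \<or> v p b = p \<and> v b p = b)"
        using v_edge[OF aD b(1)] v_edge[OF pD b(1)] no pD aD b(1)
        unfolding three_cycle_def by auto
      then show ?thesis
        using b(2) False ne by (elim disjE conjE insertE emptyE; simp)
    qed
    moreover have "{?g, ?h, ?k} \<subseteq> D" using g D by auto
    ultimately show False using w'[of ?g ?h ?k] p by blast
  qed
  then show ?thesis using X unfolding absorbing_or_cycle_def by blast
qed

end

section \<open>Polymorphisms of the atom structure and of its binarisation\<close>

lemma allowed_triples_swap12:
  assumes "\<forall>a::'a::relation_algebra. conv a = a" "(x::'a, y, z) \<in> allowed_triples"
  shows "(y, x, z) \<in> allowed_triples"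
proof -
  have "x \<odot> y = y \<odot> x" using conv_rcomp[of x y] assms(1) by simp
  then show ?thesis using assms(2) unfolding allowed_triples_def by simp
qed

text \<open>An atom \<open>y\<close> not below \<open>x \<odot> z\<close> lies below its complement.
  Tarski's last axiom then puts \<open>x \<odot> y\<close>, and with it \<open>z\<close>, below
  \<open>- z\<close>.\<close>

lemma allowed_triples_swap23:
  assumes sym: "\<forall>a::'a::relation_algebra. conv a = a" and xyz: "(x::'a, y, z) \<in> allowed_triples"
  shows "(x, z, y) \<in> allowed_triples"
proof -
  have A: "x \<in> atoms" "y \<in> atoms" "z \<in> atoms" "z \<le> x \<odot> y"
    using xyz unfolding allowed_triples_def by auto
  have comm: "s \<odot> t = t \<odot> s" for s t :: 'a using conv_rcomp[of s t] sym by simp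
  have "y \<le> x \<odot> z"
  proof (rule ccontr)
    assume n: "\<not> y \<le> x \<odot> z"
    have "inf y (x \<odot> z) = bot \<or> inf y (x \<odot> z) = y"
      using A(2) unfolding atoms_def by simp
    then have "inf y (x \<odot> z) = bot" using n by (metis inf.cobounded2)
    then have y: "y \<le> - (x \<odot> z)" by (metis inf_shunt)
    have "sup y (- (x \<odot> z)) \<odot> x = sup (y \<odot> x) (- (x \<odot> z) \<odot> x)" by (rule rcomp_sup)
    then have "x \<odot> y \<le> x \<odot> (- (x \<odot> z))"
      using y by (metis comm sup.absorb2 sup.cobounded1)
    also have "\<dots> \<le> - z" using conv_rcomp_compl[of x z] sym by simp
    finally have "z \<le> - z" using A(4) by (rule order_trans[rotated])
    then have "inf z z = bot" by (metis inf_shunt)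
    then show False using A(3) unfolding atoms_def by simp
  qed
  then show ?thesis using A unfolding allowed_triples_def by simp
qed

lemma Pol_interp:
  assumes "f \<in> Pol C n" "r \<in> symbols C" "t \<in> interp (power_structure C n) r"
  shows "map f t \<in> interp C r"
proof -
  have "symbols (power_structure C n) = symbols C" by (simp add: power_structure_def)
  then show ?thesis using assms unfolding Pol_def homomorphism_def by blast
qed

lemma Pol_binarisation_conservative:
  assumes f: "f \<in> Pol binarisation n" and xs: "xs \<in> tuples atoms n"
  shows "f xs \<in> set xs"
proof -
  have s: "U (set xs) \<in> symbols binarisation"
    using xs unfolding binarisation_def tuples_def by auto
  have "[xs] \<in> interp (power_structure binarisation n) (U (set xs))"
    using xs unfolding power_structure_def binarisation_def tuples_def by auto
  then have "map f [xs] \<in> interp binarisation (U (set xs))"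
    by (rule Pol_interp[OF f s])
  then show ?thesis unfolding binarisation_def by simp
qed

text \<open>The union of slices over the entries of the first column contains every row. Its
  preservation yields a correction from that column.\<close>

lemma Pol_binarisation_Slices:
  assumes f: "f \<in> Pol binarisation n"
    and t: "xs \<in> tuples atoms n" "ys \<in> tuples atoms n" "zs \<in> tuples atoms n"
    and a: "\<forall>i<n. (xs ! i, ys ! i, zs ! i) \<in> allowed_triples"
  shows "\<exists>x\<in>set xs. (x, f ys, f zs) \<in> allowed_triples"
proof -
  have s: "Slices (set xs) \<in> symbols binarisation"
    using t unfolding binarisation_def tuples_def by auto
  have "[ys, zs] \<in> interp (power_structure binarisation n) (Slices (set xs))"
    using t a unfolding power_structure_def binarisation_def tuples_def by fastforce
  then have "map f [ys, zs] \<in> interp binarisation (Slices (set xs))"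
    by (rule Pol_interp[OF f s])
  then show ?thesis unfolding binarisation_def by auto
qed

text \<open>For a single slice, a constant first column is added, which conservativity maps to its
  value. For a union, a witness is chosen in each row, and conservativity keeps the value on the
  witnesses inside the index set.\<close>

lemma Pol_binarisationI:
  assumes c: "\<And>xs. xs \<in> tuples (atoms :: 'a::relation_algebra set) n \<Longrightarrow> f xs \<in> set xs"
    and r: "\<And>xs ys zs. xs \<in> tuples atoms n \<Longrightarrow> ys \<in> tuples atoms n \<Longrightarrow> zs \<in> tuples atoms n \<Longrightarrow>
      (\<forall>i<n. (xs ! i, ys ! i, zs ! i) \<in> allowed_triples) \<Longrightarrow> (f xs, f ys, f zs) \<in> allowed_triples"
  shows "f \<in> Pol binarisation n"
  unfolding Pol_def homomorphism_def
proof (intro CollectI conjI ballI)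
  show "f ` universe (power_structure binarisation n) \<subseteq> universe binarisation"
    using c unfolding power_structure_def binarisation_def tuples_def by fastforce
next
  fix q :: "'a bin_symbol" and t
  assume "t \<in> interp (power_structure binarisation n) q"
  then have t: "t \<in> tuples (tuples atoms n) (arity binarisation q)"
    "\<forall>i<n. map (\<lambda>x. x ! i) t \<in> interp binarisation q"
    unfolding power_structure_def binarisation_def by auto
  show "map f t \<in> interp binarisation q"
  proof (cases q)
    case (U S)
    then obtain xs where xs: "t = [xs]" "xs \<in> tuples atoms n"
      using t(1) unfolding tuples_def[of "tuples atoms n"] binarisation_def
      by (auto simp: length_Suc_conv)
    then have "xs ! i \<in> S" if "i < n" for i
      using t(2) that U unfolding binarisation_def by auto
    then have "set xs \<subseteq> S" using xs(2) unfolding tuples_def by (auto simp: in_set_conv_nth)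
    then show ?thesis using c[OF xs(2)] U xs(1) unfolding binarisation_def by auto
  next
    case (Slice a)
    then obtain ys zs where yz: "t = [ys, zs]" "ys \<in> tuples atoms n" "zs \<in> tuples atoms n"
      using t(1) unfolding tuples_def[of "tuples atoms n"] binarisation_def
      by (auto simp: length_Suc_conv numeral_2_eq_2)
    have a: "(a, ys ! i, zs ! i) \<in> allowed_triples" if "i < n" for i
      using t(2) that Slice yz(1) unfolding binarisation_def by auto
    show ?thesis
    proof (cases n)
      case 0
      \<comment> \<open>For \<open>n = 0\<close> conservativity would put a value into the empty
        set.\<close>
      then show ?thesis using c[OF yz(2)] yz(2) unfolding tuples_def by auto
    next
      case (Suc k)
      then have "a \<in> atoms" using a[of 0] unfolding allowed_triples_def by simp
      then have as: "replicate n a \<in> tuples atoms n" unfolding tuples_def by auto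
      then have "f (replicate n a) = a" using c[OF as] by auto
      then show ?thesis
        using r[OF as yz(2,3)] a Slice yz(1) unfolding binarisation_def by simp
    qed
  next
    case (Slices S)
    then obtain ys zs where yz: "t = [ys, zs]" "ys \<in> tuples atoms n" "zs \<in> tuples atoms n"
      using t(1) unfolding tuples_def[of "tuples atoms n"] binarisation_def
      by (auto simp: length_Suc_conv numeral_2_eq_2)
    have "\<forall>i<n. \<exists>a. a \<in> S \<and> (a, ys ! i, zs ! i) \<in> allowed_triples"
      using t(2) Slices yz(1) unfolding binarisation_def by auto
    then obtain g where g: "\<forall>i<n. g i \<in> S \<and> (g i, ys ! i, zs ! i) \<in> allowed_triples"
      by metis
    have as: "map g [0..<n] \<in> tuples atoms n"
      using g unfolding tuples_def allowed_triples_def by auto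
    then have "f (map g [0..<n]) \<in> S" using c[OF as] g by auto
    then show ?thesis
      using r[OF as yz(2,3)] g Slices yz(1) unfolding binarisation_def by auto
  qed
qed

lemma Pol_atom_structureI:
  assumes sym: "\<forall>a::'a::relation_algebra. conv a = a"
    and c: "\<And>xs. xs \<in> tuples (atoms :: 'a set) n \<Longrightarrow> f xs \<in> set xs"
    and r: "\<And>xs ys zs. xs \<in> tuples atoms n \<Longrightarrow> ys \<in> tuples atoms n \<Longrightarrow> zs \<in> tuples atoms n \<Longrightarrow>
      (\<forall>i<n. (xs ! i, ys ! i, zs ! i) \<in> allowed_triples) \<Longrightarrow> (f xs, f ys, f zs) \<in> allowed_triples"
  shows "f \<in> Pol atom_structure n"
  unfolding Pol_def homomorphism_def
proof (intro CollectI conjI ballI)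
  show "f ` universe (power_structure atom_structure n) \<subseteq> universe atom_structure"
    using c unfolding power_structure_def atom_structure_def tuples_def by fastforce
next
  fix q :: "'a atom_symbol" and t
  assume "t \<in> interp (power_structure atom_structure n) q"
  then have t: "t \<in> tuples (tuples atoms n) (arity atom_structure q)"
    "\<forall>i<n. map (\<lambda>x. x ! i) t \<in> interp atom_structure q"
    unfolding power_structure_def atom_structure_def by auto
  show "map f t \<in> interp atom_structure q"
  proof (cases q)
    case (Unary S)
    then obtain xs where xs: "t = [xs]" "xs \<in> tuples atoms n"
      using t(1) unfolding tuples_def[of "tuples atoms n"] atom_structure_def
      by (auto simp: length_Suc_conv)
    then have "xs ! i \<in> S" if "i < n" for i
      using t(2) that Unary unfolding atom_structure_def by auto
    then have "set xs \<subseteq> S" using xs(2) unfolding tuples_def by (auto simp: in_set_conv_nth)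
    then show ?thesis using c[OF xs(2)] Unary xs(1) unfolding atom_structure_def by auto
  next
    case Converse
    then obtain xs ys where xy: "t = [xs, ys]" "xs \<in> tuples atoms n" "ys \<in> tuples atoms n"
      using t(1) unfolding tuples_def[of "tuples atoms n"] atom_structure_def
      by (auto simp: length_Suc_conv numeral_2_eq_2)
    \<comment> \<open>By symmetry of the algebra the converse relation is equality.\<close>
    have "xs ! i = ys ! i" if "i < n" for i
      using t(2) that Converse xy(1) sym unfolding atom_structure_def by auto
    then have "xs = ys" using xy unfolding tuples_def by (auto intro: nth_equalityI)
    moreover have "f xs \<in> atoms" using c[OF xy(2)] xy(2) unfolding tuples_def by auto
    ultimately show ?thesis using Converse xy(1) sym unfolding atom_structure_def by auto
  next
    case Allowed
    then obtain xs ys zs where xyz: "t = [xs, ys, zs]"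
        "xs \<in> tuples atoms n" "ys \<in> tuples atoms n" "zs \<in> tuples atoms n"
      using t(1) unfolding tuples_def[of "tuples atoms n"] atom_structure_def
      by (auto simp: length_Suc_conv numeral_3_eq_3)
    then show ?thesis
      using r[OF xyz(2-4)] t(2) Allowed unfolding atom_structure_def by auto
  qed
qed

section \<open>Transfer to the relation algebra\<close>

theorem theoremB12:
  fixes B :: "('a::{relation_algebra, finite}, 'd) rel_structure"
    and v w u :: "'a list \<Rightarrow> 'a"
  assumes symmetric: "\<forall>a::'a. conv a = a"
    and normal: "normal_representation B"
    and one_cycles: "\<forall>a \<in> (atoms :: 'a set). (a, a, a) \<in> allowed_triples"
    and siggers_beh: "\<exists>s :: 'a list \<Rightarrow> 'a. siggers_behavior s"
    and siggers_pol: "\<exists>s \<in> Pol (binarisation :: ('a bin_symbol, 'a) rel_structure) 6.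
        siggers_on atoms s"
    and no_affine: "\<nexists>C. affine_edge (binarisation :: ('a bin_symbol, 'a) rel_structure) C"
    and v_pol: "v \<in> Pol binarisation 2"
    and w_pol: "w \<in> Pol binarisation 3"
    and v_semilattice: "\<forall>C \<subseteq> atoms. card C = 2 \<and> has_semilattice_edge binarisation C \<longrightarrow>
        semilattice_op_on C v"
    and v_projection: "\<forall>C \<subseteq> atoms. card C = 2 \<and> \<not> has_semilattice_edge binarisation C \<longrightarrow>
        (\<forall>x \<in> C. \<forall>y \<in> C. v [x, y] = x)"
    and w_majority: "\<forall>C \<subseteq> atoms. card C = 2 \<and> majority_edge binarisation C \<longrightarrow>
        majority_op_on C w"
    and w_semilattice: "\<forall>C \<subseteq> atoms. card C = 2 \<and> has_semilattice_edge binarisation C \<longrightarrow>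
        (\<forall>x \<in> C. \<forall>y \<in> C. \<forall>z \<in> C. w [x, y, z] = v [v [x, y], z])"
    and u_def: "\<forall>x \<in> atoms. \<forall>y \<in> atoms. \<forall>z \<in> atoms.
        u [x, y, z] = w [v [v [x, y], z], v [v [y, z], x], v [v [z, x], y]]"
    and u_pol: "u \<in> Pol binarisation 3"
  shows "u \<in> Pol atom_structure 3"
proof -
  let ?R = "\<lambda>x y z :: 'a. (x, y, z) \<in> allowed_triples"
  let ?bin = "binarisation :: ('a bin_symbol, 'a) rel_structure"
  have uni: "universe ?bin = atoms" unfolding binarisation_def by simp
  interpret symmetric_triples "atoms :: 'a set" ?R
  proof unfold_locales
    show "?R x y z \<Longrightarrow> x \<in> atoms \<and> y \<in> atoms \<and> z \<in> atoms" for x y z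
      by (simp add: allowed_triples_def)
    show "?R x y z \<Longrightarrow> ?R y x z" for x y z
      by (rule allowed_triples_swap12[OF symmetric])
    show "?R x y z \<Longrightarrow> ?R x z y" for x y z
      by (rule allowed_triples_swap23[OF symmetric])
  qed (use one_cycles in simp_all)
  define v2 where "v2 = (\<lambda>x y. v [x, y])"
  define w3 where "w3 = (\<lambda>x y z. w [x, y, z])"
  have v2_cons: "v2 a b = a \<or> v2 a b = b" if "a \<in> atoms" "b \<in> atoms" for a b
    using Pol_binarisation_conservative[OF v_pol, of "[a, b]"] that
    by (auto simp: v2_def tuples_def)
  have w3_cons: "w3 a b c \<in> {a, b, c}" if "a \<in> atoms" "b \<in> atoms" "c \<in> atoms" for a b c
    using Pol_binarisation_conservative[OF w_pol, of "[a, b, c]"] that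
    by (auto simp: w3_def tuples_def)
  have v2_slices: "?R x (v2 y y') (v2 z z') \<or> ?R x' (v2 y y') (v2 z z')"
    if "?R x y z" "?R x' y' z'" for x y z x' y' z'
    using Pol_binarisation_Slices[OF v_pol, of "[x, x']" "[y, y']" "[z, z']"]
      R_in[OF that(1)] R_in[OF that(2)] that
    by (auto simp: v2_def tuples_def less_2_cases_iff)
  \<comment> \<open>Without a semilattice edge in the binarisation the pair is rigid: a binary
    operation preserving \<open>R\<close> and commuting on the pair would be a polymorphism of the
    binarisation witnessing such an edge.\<close>
  have edge: "v2 a b = v2 b a \<and> has_semilattice_edge ?bin {a, b} \<or>
      v2 a b = a \<and> v2 b a = b \<and> rigid a b"
    if ab: "a \<in> atoms" "b \<in> atoms" "a \<noteq> b" for a b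
  proof (cases "has_semilattice_edge ?bin {a, b}")
    case True
    then have "semilattice_op_on {a, b} v" using v_semilattice[THEN spec, of "{a, b}"] ab by simp
    then have "v [a, b] = v [b, a]" unfolding semilattice_op_on_def by blast
    then show ?thesis using True unfolding v2_def by blast
  next
    case False
    have "f a b \<noteq> f b a" if f: "pol2 f" for f
    proof
      assume eq: "f a b = f b a"
      have p: "(\<lambda>l. f (l ! 0) (l ! 1)) \<in> Pol ?bin 2"
      proof (rule Pol_binarisationI)
        show "f (xs ! 0) (xs ! 1) \<in> set xs" if "xs \<in> tuples atoms 2" for xs
          using that pol2_cases[OF f] by (auto simp: tuples_def length_Suc_conv numeral_2_eq_2)
      qed (use pol2_R[OF f] in auto)
      have i: "f a a = a" "f b b = b" using pol2_cases[OF f] ab by blast+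
      have "semilattice_edge ?bin a b \<or> semilattice_edge ?bin b a"
        using pol2_cases[OF f ab(1,2)] p i eq ab uni
        unfolding semilattice_edge_def by (auto intro!: bexI[OF _ p])
      then show False
        using False ab uni unfolding has_semilattice_edge_def two_subset_def
        by (auto simp: insert_commute)
    qed
    moreover have "v2 a b = a" "v2 b a = b"
      using v_projection[THEN spec, of "{a, b}"] False ab unfolding v2_def by simp_all
    ultimately show ?thesis using ab unfolding rigid_def by blast
  qed
  have "pol2 v2"
  proof (rule pol2_of_slices)
    show "v2 a b = v2 b a \<or> v2 a b = a \<and> v2 b a = b" if "a \<in> atoms" "b \<in> atoms" for a b
      using edge[OF that] by blast
  qed (use v2_cons v2_slices in blast)+
  obtain s :: "'a list \<Rightarrow> 'a" where s: "siggers_behavior s" using siggers_beh by blast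
  let ?s = "\<lambda>a b c d e f. s [a, b, c, d, e, f]"
  have "pol6 ?s"
    unfolding pol6_def
  proof (intro conjI ballI allI impI)
    show "s [a, b, c, d, e, f] \<in> {a, b, c, d, e, f}"
      if "a \<in> atoms" "b \<in> atoms" "c \<in> atoms" "d \<in> atoms" "e \<in> atoms" "f \<in> atoms"
      for a b c d e f
    proof -
      have "[a, b, c, d, e, f] \<in> tuples atoms 6" using that by (simp add: tuples_def)
      then have "s [a, b, c, d, e, f] \<in> set [a, b, c, d, e, f]"
        using s unfolding siggers_behavior_def by blast
      then show ?thesis by simp
    qed
  next
    fix a b c d e f a' b' c' d' e' f' a'' b'' c'' d'' e'' f''
    assume r: "?R a a' a''" "?R b b' b''" "?R c c' c''" "?R d d' d''" "?R e e' e''" "?R f f' f''"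
    have "[a, b, c, d, e, f] \<in> tuples atoms 6" "[a', b', c', d', e', f'] \<in> tuples atoms 6"
      "[a'', b'', c'', d'', e'', f''] \<in> tuples atoms 6"
      using r by (auto simp: tuples_def allowed_triples_def)
    moreover have "\<forall>i<6. ?R ([a, b, c, d, e, f] ! i) ([a', b', c', d', e', f'] ! i)
        ([a'', b'', c'', d'', e'', f''] ! i)"
      using r by (simp add: numeral_eq_Suc All_less_Suc2)
    ultimately show "?R (s [a, b, c, d, e, f]) (s [a', b', c', d', e', f'])
        (s [a'', b'', c'', d'', e'', f''])"
      using s unfolding siggers_behavior_def by blast
  qed
  then have dich: "has_maj a b \<or> (\<exists>f. pol3 f \<and> min_on f a b)" if "rigid a b" for a b
    using siggers_dichotomy[OF _ _ that, of ?s] s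
    unfolding siggers_behavior_def siggers_on_def by blast
  obtain m where m: "pol3 m"
    "\<And>a b. rigid a b \<Longrightarrow> if has_maj a b then maj_on m a b else fst_on m a b"
    using uniform_maj by blast
  obtain d where d: "pol3 d" "\<And>a b. rigid a b \<Longrightarrow> \<not> has_maj a b \<Longrightarrow> min_on d a b"
    using uniform_min[OF dich] by blast
  interpret edge_coloured_triples "atoms :: 'a set" ?R v2 m d
  proof unfold_locales
    fix a b :: 'a assume "a \<in> atoms" "b \<in> atoms" "a \<noteq> b"
    from edge[OF this] show "v2 a b = v2 b a \<or>
        v2 a b = a \<and> v2 b a = b \<and> (maj_on m a b \<or> fst_on m a b \<and> min_on d a b)"
      using m(2)[of a b] d(2)[of a b] by (auto split: if_splits)
  qed fact+
  have w3_edge: "w3 x y z = v2 (v2 x y) z"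
    if "a \<in> atoms" "b \<in> atoms" "a \<noteq> b" "v2 a b = v2 b a"
      "x \<in> {a, b}" "y \<in> {a, b}" "z \<in> {a, b}" for a b x y z
  proof -
    have "has_semilattice_edge ?bin {a, b}" using edge[OF that(1-3)] that(3,4) by auto
    then have "\<forall>x\<in>{a, b}. \<forall>y\<in>{a, b}. \<forall>z\<in>{a, b}. w [x, y, z] = v [v [x, y], z]"
      using w_semilattice[THEN spec, of "{a, b}", THEN mp, THEN mp] that(1-3) by auto
    then show ?thesis using that(5-7) unfolding v2_def w3_def by blast
  qed
  have u_outcome: "absorbing_or_cycle (u [x, y, z]) {x, y, z}"
    if "x \<in> atoms" "y \<in> atoms" "z \<in> atoms" for x y z
  proof (rule absorbing_or_cycle_outcome[OF that w3_cons w3_edge])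
    show "u [x, y, z] = w3 (v2 (v2 x y) z) (v2 (v2 y z) x) (v2 (v2 z x) y)"
      using u_def that unfolding v2_def w3_def by blast
  qed
  show ?thesis
  proof (rule Pol_atom_structureI[OF symmetric Pol_binarisation_conservative[OF u_pol]])
    fix xs ys zs :: "'a list"
    assume t: "xs \<in> tuples atoms 3" "ys \<in> tuples atoms 3" "zs \<in> tuples atoms 3"
      and a: "\<forall>i<3. ?R (xs ! i) (ys ! i) (zs ! i)"
    have out: "absorbing_or_cycle (u ts) (set ts)" if ts: "ts \<in> tuples atoms 3" for ts
    proof -
      obtain x y z where "ts = [x, y, z]" "x \<in> atoms" "y \<in> atoms" "z \<in> atoms"
        using ts by (auto simp: tuples_def length_Suc_conv numeral_3_eq_3)
      then show ?thesis using u_outcome by simp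
    qed
    have row: "xs ! i \<in> set xs" "ys ! i \<in> set ys" "zs ! i \<in> set zs" if "i < 3" for i
      using t that by (auto simp: tuples_def)
    have idx: "\<exists>i<3. x = ts ! i" if "ts \<in> tuples atoms 3" "x \<in> set ts" for ts and x :: 'a
      using that by (auto simp: tuples_def in_set_conv_nth)
    show "?R (u xs) (u ys) (u zs)"
    \<comment> \<open>The corrections arise from the slices of \<open>u\<close> with each column in
      turn placed first; the original rows pass through every entry of every column.\<close>
    proof (rule R_decomposable_general[OF out[OF t(1)] out[OF t(2)] out[OF t(3)]])
      show "\<exists>x\<in>set xs. ?R x (u ys) (u zs)"
        using Pol_binarisation_Slices[OF u_pol t a] .
      show "\<exists>y\<in>set ys. ?R (u xs) y (u zs)"
        using Pol_binarisation_Slices[OF u_pol t(2,1,3)] a R_swap12 by blast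
      show "\<exists>z\<in>set zs. ?R (u xs) (u ys) z"
        using Pol_binarisation_Slices[OF u_pol t(3,1,2)] a R_perms(3,4) by blast
      show "\<exists>y\<in>set ys. \<exists>z\<in>set zs. ?R x y z" if "x \<in> set xs" for x
        using idx[OF t(1) that] row a by blast
      show "\<exists>x\<in>set xs. \<exists>z\<in>set zs. ?R x y z" if "y \<in> set ys" for y
        using idx[OF t(2) that] row a by blast
      show "\<exists>x\<in>set xs. \<exists>y\<in>set ys. ?R x y z" if "z \<in> set zs" for z
        using idx[OF t(3) that] row a by blast
    qed
  qed
qed

end
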